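(* Consider problem $\min_{\mathbf x\in\mathbb R^n}F(\mathbf x)=\sum_{i=1}^I f_i(\mathbf x)$ where each $f_i$ is proper, closed and $L_i$-Lipschitz differentiable (possibly nonconvex) and $F$ is bounded from below. Let $\{(\mathbf x_i^k)_{i=1}^I\}_k$ be generated by ASY-SONATA (as in the context) with constant step-size $\gamma^k\equiv\gamma$. For $\delta>0$ let $T_\delta$ be the first $k\in\mathbb N_0$ with $M_F(\mathbf x^k)\le\delta$. Then there exists $\bar\gamma_2>0$ such that for every $\gamma\in(0,\bar\gamma_2)$, $T_\delta=\mathcal O(1/\delta)$.
   Context: Graph: $\mathcal G=(\mathcal V,\mathcal E)$, $\mathcal V=\{1,\dots,I\}$, strongly connected digraph without self-loops; $\mathcal N_i^{\rm in}=\{j:(j,i)\in\mathcal E\}$, $\mathcal N_i^{\rm out}=\{j:(i,j)\in\mathcal E\}$. Weight matrices $W=(w_{ij})$ (row-stochastic) and $A=(a_{ij})$ (column-stochastic) satisfy, for some $\bar m\in(0,1)$: diagonal entries $\ge\bar m$, entries $(i,j)$ with $(j,i)\in\mathcal E$ are $\ge\bar m$, all other entries $0$. Asynchrony model: $(i^k,\mathbf d^k)_{k\in\mathbb N_0}$, $i^k\in\mathcal V$, $\mathbf d^k=(d_j^k)_{j\in\mathcal N^{\rm in}_{i^k}}$, with every agent appearing among $i^k,\dots,i^{k+T-1}$ for all $k$ and $0\le d_j^k\le D$. ASY-SONATA: initialization $\mathbf x_i^0\in\mathbb R^n$, $\mathbf z_i^0=\nabla f_i(\mathbf x_i^0)$,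 $\tilde{\boldsymbol\rho}_{ij}^0=0$, $\tau_{ij}^{-1}=-D$, and $\boldsymbol\rho_{ij}^t=0$, $\mathbf v_i^t=0$ for $t=-D,\dots,0$. At iteration $k$ with $i=i^k$: (1) $\tau_{ij}^k=\max(\tau_{ij}^{k-1},k-d_j^k)$, $j\in\mathcal N_i^{\rm in}$; (2) $\mathbf v_i^{k+1}=\mathbf x_i^k-\gamma^k\mathbf z_i^k$; (3) $\mathbf x_i^{k+1}=w_{ii}\mathbf v_i^{k+1}+\sum_{j\in\mathcal N_i^{\rm in}}w_{ij}\mathbf v_j^{\tau_{ij}^k}$; (4) $\mathbf z_i^{k+1/2}=\mathbf z_i^k+\sum_{j\in\mathcal N_i^{\rm in}}(\boldsymbol\rho_{ij}^{\tau_{ij}^k}-\tilde{\boldsymbol\rho}_{ij}^k)+\nabla f_i(\mathbf x_i^{k+1})-\nabla f_i(\mathbf x_i^k)$; (5) $\mathbf z_i^{k+1}=a_{ii}\mathbf z_i^{k+1/2}$ and $\boldsymbol\rho_{ji}^{k+1}=\boldsymbol\rho_{ji}^k+a_{ji}\mathbf z_i^{k+1/2}$ for $j\in\mathcal N_i^{\rm out}$; (6) $\tilde{\boldsymbol\rho}_{ij}^{k+1}=\boldsymbol\rho_{ij}^{\tau_{ij}^k}$ for $j\in\mathcal N_i^{\rm in}$; (7) all other variables keep their values. Merit function: with $\mathbf x^k=[\mathbf x_1^{k\top},\dots,\mathbf x_I^{k\top}]^\top$ and $\bar{\mathbf x}^k=\frac1I\sum_i\mathbf x_i^k$, $M_F(\mathbf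 x^k)=\max\{\|\nabla F(\bar{\mathbf x}^k)\|^2,\|\mathbf x^k-\mathbf 1_I\otimes\bar{\mathbf x}^k\|^2\}$. *)

theory Defs
  imports "HOL-Analysis.Analysis"
begin

definition Nin :: "('v \<times> 'v) set \<Rightarrow> 'v \<Rightarrow> 'v set" where
  "Nin E i = {j. (j, i) \<in> E}"

definition Nout :: "('v \<times> 'v) set \<Rightarrow> 'v \<Rightarrow> 'v set" where
  "Nout E i = {j. (i, j) \<in> E}"

definition weight_pattern :: "('v \<times> 'v) set \<Rightarrow> real \<Rightarrow> ('v \<Rightarrow> 'v \<Rightarrow> real) \<Rightarrow> bool" where
  "weight_pattern E mbar M \<longleftrightarrow>
     (\<forall>i. M i i \<ge> mbar) \<and>
     (\<forall>i j. (j, i) \<in> E \<longrightarrow> M i j \<ge> mbar) \<and>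
     (\<forall>i j. i \<noteq> j \<and> (j, i) \<notin> E \<longrightarrow> M i j = 0)"

definition row_stochastic :: "('v::finite \<Rightarrow> 'v \<Rightarrow> real) \<Rightarrow> bool" where
  "row_stochastic M \<longleftrightarrow> (\<forall>i j. M i j \<ge> 0) \<and> (\<forall>i. (\<Sum>j\<in>UNIV. M i j) = 1)"

definition col_stochastic :: "('v::finite \<Rightarrow> 'v \<Rightarrow> real) \<Rightarrow> bool" where
  "col_stochastic M \<longleftrightarrow> (\<forall>i j. M i j \<ge> 0) \<and> (\<forall>j. (\<Sum>i\<in>UNIV. M i j) = 1)"

definition admissible_schedule ::
  "('v \<times> 'v) set \<Rightarrow> nat \<Rightarrow> nat \<Rightarrow> (nat \<Rightarrow> 'v) \<Rightarrow> (nat \<Rightarrow> 'v \<Rightarrow> nat) \<Rightarrow> bool" where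
  "admissible_schedule E T D sched d \<longleftrightarrow>
     (\<forall>k i. \<exists>t. k \<le> t \<and> t < k + T \<and> sched t = i) \<and>
     (\<forall>k j. j \<in> Nin E (sched k) \<longrightarrow> d k j \<le> D)"

text \<open>ASY-SONATA trajectory with constant step-size gamma.
  x, z, rho_tilde are indexed by iterations k \<in> N_0; v, rho (which are read with delays)
  and tau are indexed by integer times (v,rho from -D, tau from -1).
  Convention: rho t j i is rho_{ji}^t; tau t i j is tau_{ij}^t; rt k i j is rho_tilde_{ij}^k.\<close>
definition asy_sonata ::
  "('v::finite \<times> 'v) set \<Rightarrow> ('v \<Rightarrow> 'v \<Rightarrow> real) \<Rightarrow> ('v \<Rightarrow> 'v \<Rightarrow> real) \<Rightarrow>
   ('v \<Rightarrow> 'a::euclidean_space \<Rightarrow> 'a) \<Rightarrow> nat \<Rightarrow> real \<Rightarrow>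
   (nat \<Rightarrow> 'v) \<Rightarrow> (nat \<Rightarrow> 'v \<Rightarrow> nat) \<Rightarrow>
   (nat \<Rightarrow> 'v \<Rightarrow> 'a) \<Rightarrow> (nat \<Rightarrow> 'v \<Rightarrow> 'a) \<Rightarrow> (int \<Rightarrow> 'v \<Rightarrow> 'a) \<Rightarrow>
   (int \<Rightarrow> 'v \<Rightarrow> 'v \<Rightarrow> 'a) \<Rightarrow> (nat \<Rightarrow> 'v \<Rightarrow> 'v \<Rightarrow> 'a) \<Rightarrow> (int \<Rightarrow> 'v \<Rightarrow> 'v \<Rightarrow> int) \<Rightarrow> bool" where
  "asy_sonata E W A grad D \<gamma> sched d x z v rho rt tau \<longleftrightarrow>
     (\<forall>i. z 0 i = grad i (x 0 i)) \<and>
     (\<forall>i j. rt 0 i j = 0) \<and>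
     (\<forall>i j. tau (-1) i j = - int D) \<and>
     (\<forall>t i j. - int D \<le> t \<and> t \<le> 0 \<longrightarrow> rho t i j = 0) \<and>
     (\<forall>t i. - int D \<le> t \<and> t \<le> 0 \<longrightarrow> v t i = 0) \<and>
     (\<forall>k. let i = sched k; kk = int k in
        (\<forall>i' j. tau kk i' j =
            (if i' = i \<and> j \<in> Nin E i then max (tau (kk - 1) i j) (kk - int (d k j))
             else tau (kk - 1) i' j)) \<and>
        (\<forall>i'. v (kk + 1) i' = (if i' = i then x k i - \<gamma> *\<^sub>R z k i else v kk i')) \<and>
        (\<forall>i'. x (Suc k) i' =
            (if i' = i then W i i *\<^sub>R v (kk + 1) i + (\<Sum>j\<in>Nin E i. W i j *\<^sub>R v (tau kk i j) j)
             else x k i')) \<and>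
        (let zh = z k i + (\<Sum>j\<in>Nin E i. rho (tau kk i j) i j - rt k i j)
                  + grad i (x (Suc k) i) - grad i (x k i) in
          (\<forall>i'. z (Suc k) i' = (if i' = i then A i i *\<^sub>R zh else z k i')) \<and>
          (\<forall>j l. rho (kk + 1) j l =
              (if l = i \<and> j \<in> Nout E i then rho kk j i + A j i *\<^sub>R zh else rho kk j l))) \<and>
        (\<forall>i' j. rt (Suc k) i' j =
            (if i' = i \<and> j \<in> Nin E i then rho (tau kk i j) i j else rt k i' j)))"

definition xbar :: "('v::finite \<Rightarrow> 'a::euclidean_space) \<Rightarrow> 'a" where
  "xbar xs = (1 / real CARD('v)) *\<^sub>R (\<Sum>i\<in>UNIV. xs i)"

definition merit :: "('v::finite \<Rightarrow> 'a::euclidean_space \<Rightarrow> 'a) \<Rightarrow> ('v \<Rightarrow> 'a) \<Rightarrow> real" where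
  "merit grad xs = max ((norm (\<Sum>i\<in>UNIV. grad i (xbar xs)))\<^sup>2)
                       (\<Sum>i\<in>UNIV. (norm (xs i - xbar xs))\<^sup>2)"

end

theory Submission
  imports Defs
begin

text \<open>Both halves of the algorithm are linear recursions on finitely many nodes once delays are
  unfolded. The iterates \<open>x\<close> and the last \<open>D + 1\<close> values of \<open>v\<close> evolve by row-stochastic matrices driven
  by the input \<open>-\<gamma> z\<close>; the trackers \<open>z\<close> together with the packets in transit evolve by column-stochastic
  matrices driven by the gradient increments, and their total mass is always the sum of the local
  gradients. Products of boundedly many of these matrices have a uniformly positive column,
  respectively row, so the disagreement \<open>S\<^sub>k\<close> of the iterates and the \<open>\<ell>\<^sub>1\<close> tracking error \<open>E\<^sub>k\<close> contract
  up to their inputs, whence \<open>\<Sum> S\<^sub>k\<^sup>2 + E\<^sub>k\<^sup>2 \<le> C + c \<gamma>\<^sup>2 \<Sum> \<parallel>z\<parallel>\<^sup>2\<close>.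

  For a finite horizon \<open>N\<close>, pulling a unit row vector back from time \<open>N\<close> gives weights \<open>\<psi>\<^sub>k\<close> for which the
  average \<open>x\<^sub>\<psi>\<close> of the augmented state moves exactly by \<open>-\<gamma> \<psi> z\<close>; pushing a unit mass forward from
  time \<open>0\<close> gives \<open>\<xi>\<^sub>k\<close> with \<open>z \<approx> \<xi> \<nabla>F(x\<^sub>\<psi>)\<close>. Both weights are bounded below away from the ends of the
  horizon, so \<open>F(x\<^sub>\<psi>)\<close> decreases by a multiple of \<open>\<gamma> \<parallel>\<nabla>F(x\<^sub>\<psi>)\<parallel>\<^sup>2\<close> up to \<open>S\<^sub>k\<close>, \<open>E\<^sub>k\<close> and \<open>O(\<gamma>\<^sup>2)\<close> terms.
  For small \<open>\<gamma>\<close> the inequalities close and the merit function is summable with a bound independent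
  of \<open>N\<close>; a summable sequence that exceeds \<open>\<delta>\<close> up to time \<open>T\<^sub>\<delta>\<close> has \<open>\<delta> T\<^sub>\<delta>\<close> bounded.\<close>

subsection \<open>Products of stochastic matrices\<close>

text \<open>The index set is an explicit \<open>S\<close> instead of a type because the push system
  lives on \<open>push_nodes N\<close>, which grows with the horizon. New factors enter on the left:
  rows belong to time \<open>s + t\<close>, columns to time \<open>s\<close>.\<close>

fun mprod :: "'s set \<Rightarrow> (nat \<Rightarrow> 's \<Rightarrow> 's \<Rightarrow> real) \<Rightarrow> nat \<Rightarrow> nat \<Rightarrow> 's \<Rightarrow> 's \<Rightarrow> real" where
  "mprod S M s 0 a b = (if a = b then 1 else 0)"
| "mprod S M s (Suc t) a b = (\<Sum>c\<in>S. M (s + t) a c * mprod S M s t c b)"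

lemma mprod_add:
  assumes "finite S" "a \<in> S"
  shows "mprod S M s (t + r) a b = (\<Sum>c\<in>S. mprod S M (s + t) r a c * mprod S M s t c b)"
  using assms(2)
proof (induction r arbitrary: a)
  case 0
  have "(\<Sum>c\<in>S. mprod S M (s + t) 0 a c * mprod S M s t c b)
      = (\<Sum>c\<in>S. if a = c then mprod S M s t c b else 0)"
    by (intro sum.cong) auto
  then show ?case using 0 assms(1) by simp
next
  case (Suc r)
  have "mprod S M s (t + Suc r) a b
      = (\<Sum>c\<in>S. M (s + t + r) a c * (\<Sum>e\<in>S. mprod S M (s + t) r c e * mprod S M s t e b))"
    using Suc.IH by (simp add: add.assoc)
  also have "\<dots> = (\<Sum>e\<in>S. \<Sum>c\<in>S. M (s + t + r) a c * (mprod S M (s + t) r c e * mprod S M s t e b))"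
    unfolding sum_distrib_left by (rule sum.swap)
  also have "\<dots> = (\<Sum>e\<in>S. mprod S M (s + t) (Suc r) a e * mprod S M s t e b)"
    by (simp add: sum_distrib_right mult.assoc)
  finally show ?case .
qed

lemma mprod_nonneg:
  assumes "\<And>k a b. 0 \<le> M k a b"
  shows "0 \<le> mprod S M s t a b"
  by (induction t arbitrary: a) (auto intro!: sum_nonneg mult_nonneg_nonneg assms)

lemma mprod_row_sum:
  assumes "finite S" "\<And>k a. a \<in> S \<Longrightarrow> (\<Sum>b\<in>S. M k a b) = 1" "a \<in> S"
  shows "(\<Sum>b\<in>S. mprod S M s t a b) = 1"
  using assms(3)
proof (induction t arbitrary: a)
  case 0
  then show ?case using assms(1) by simp
next
  case (Suc t)
  have "(\<Sum>b\<in>S. mprod S M s (Suc t) a b) = (\<Sum>c\<in>S. M (s + t) a c * (\<Sum>b\<in>S. mprod S M s t c b))"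
    unfolding mprod.simps sum_distrib_left by (rule sum.swap)
  then show ?case using Suc assms(2) by simp
qed

lemma mprod_col_sum:
  assumes "finite S" "\<And>k b. b \<in> S \<Longrightarrow> (\<Sum>a\<in>S. M k a b) = 1" "b \<in> S"
  shows "(\<Sum>a\<in>S. mprod S M s t a b) = 1"
proof (induction t)
  case 0
  then show ?case using assms(1,3) by simp
next
  case (Suc t)
  have "(\<Sum>a\<in>S. mprod S M s (Suc t) a b) = (\<Sum>c\<in>S. (\<Sum>a\<in>S. M (s + t) a c) * mprod S M s t c b)"
    unfolding mprod.simps sum_distrib_right by (rule sum.swap)
  then show ?case using Suc assms(2) by simp
qed

text \<open>The driven trajectory minus the free evolution of its value at time \<open>s\<close>
  solves the same recursion from zero, so that it sees only the inputs since
  \<open>s\<close>.\<close>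

lemma mprod_deviation_Suc:
  fixes h u :: "nat \<Rightarrow> 's \<Rightarrow> 'a::real_vector"
  assumes "\<And>a. a \<in> S \<Longrightarrow> h (Suc (s + t)) a = (\<Sum>b\<in>S. M (s + t) a b *\<^sub>R (h (s + t) b + u (s + t) b))"
    and "a \<in> S"
  shows "h (s + Suc t) a - (\<Sum>b\<in>S. mprod S M s (Suc t) a b *\<^sub>R h s b)
    = (\<Sum>c\<in>S. M (s + t) a c *\<^sub>R
        ((h (s + t) c - (\<Sum>b\<in>S. mprod S M s t c b *\<^sub>R h s b)) + u (s + t) c))"
proof -
  have "(\<Sum>b\<in>S. mprod S M s (Suc t) a b *\<^sub>R h s b)
      = (\<Sum>c\<in>S. M (s + t) a c *\<^sub>R (\<Sum>b\<in>S. mprod S M s t c b *\<^sub>R h s b))"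
    unfolding mprod.simps scaleR_sum_left scaleR_sum_right scaleR_scaleR by (rule sum.swap)
  then show ?thesis
    using assms by (simp add: sum_subtractf[symmetric] scaleR_diff_right[symmetric] algebra_simps)
qed

section \<open>Contraction of the diameter under row-stochastic products\<close>

text \<open>The product weights \<open>p a * q b\<close> couple the two averages: \<open>c\<close>
  times their difference is a sum of differences \<open>h a - h b\<close> of total weight
  \<open>c * c\<close>.\<close>

lemma norm_diff_weighted_sums_le:
  fixes h :: "'s \<Rightarrow> 'a::real_normed_vector"
  assumes fin: "finite S" and p: "\<And>b. b \<in> S \<Longrightarrow> 0 \<le> p b" and q: "\<And>b. b \<in> S \<Longrightarrow> 0 \<le> q b"
    and ps: "sum p S = c" and qs: "sum q S = c"
    and r: "\<And>a b. a \<in> S \<Longrightarrow> b \<in> S \<Longrightarrow> norm (h a - h b) \<le> r"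
  shows "norm ((\<Sum>b\<in>S. p b *\<^sub>R h b) - (\<Sum>b\<in>S. q b *\<^sub>R h b)) \<le> c * r"
proof (cases "c = 0")
  case True
  then have "\<forall>b\<in>S. p b = 0" "\<forall>b\<in>S. q b = 0"
    using ps qs p q fin by (simp_all add: sum_nonneg_eq_0_iff)
  then show ?thesis using True by simp
next
  case False
  then have c: "c > 0" using p ps by (metis sum_nonneg order_le_less)
  have e: "c *\<^sub>R ((\<Sum>b\<in>S. p b *\<^sub>R h b) - (\<Sum>b\<in>S. q b *\<^sub>R h b))
      = (\<Sum>a\<in>S. \<Sum>b\<in>S. (p a * q b) *\<^sub>R (h a - h b))"
  proof -
    have "(\<Sum>a\<in>S. \<Sum>b\<in>S. (p a * q b) *\<^sub>R h a) = (\<Sum>a\<in>S. (p a * c) *\<^sub>R h a)"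
      by (simp add: scaleR_sum_left[symmetric] sum_distrib_left[symmetric] qs)
    moreover have "(\<Sum>a\<in>S. \<Sum>b\<in>S. (p a * q b) *\<^sub>R h b) = (\<Sum>b\<in>S. (c * q b) *\<^sub>R h b)"
      by (subst sum.swap) (simp add: scaleR_sum_left[symmetric] sum_distrib_right[symmetric] ps)
    ultimately show ?thesis
      by (simp add: scaleR_diff_right sum_subtractf scaleR_sum_right mult.commute)
  qed
  have "norm (\<Sum>a\<in>S. \<Sum>b\<in>S. (p a * q b) *\<^sub>R (h a - h b)) \<le> (\<Sum>a\<in>S. \<Sum>b\<in>S. (p a * q b) * r)"
    by (intro sum_norm_le) (auto simp: p q r intro!: mult_left_mono)
  also have "\<dots> = c * c * r"
    by (simp add: sum_distrib_left[symmetric] sum_distrib_right[symmetric] ps qs)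
  finally have "c * norm ((\<Sum>b\<in>S. p b *\<^sub>R h b) - (\<Sum>b\<in>S. q b *\<^sub>R h b)) \<le> c * (c * r)"
    unfolding e[symmetric] using c by (simp add: mult.assoc)
  then show ?thesis using c by simp
qed

definition spread :: "'s set \<Rightarrow> ('s \<Rightarrow> 'a::real_normed_vector) \<Rightarrow> real" where
  "spread S h = Max ((\<lambda>(a, b). norm (h a - h b)) ` (S \<times> S))"

lemma norm_diff_le_spread:
  assumes "finite S" "a \<in> S" "b \<in> S"
  shows "norm (h a - h b) \<le> spread S h"
  unfolding spread_def using assms by (intro Max_ge) auto

lemma spread_le:
  assumes "finite S" "S \<noteq> {}" "\<And>a b. a \<in> S \<Longrightarrow> b \<in> S \<Longrightarrow> norm (h a - h b) \<le> r"
  shows "spread S h \<le> r"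
  unfolding spread_def using assms by (subst Max_le_iff) auto

lemma spread_nonneg:
  assumes "finite S" "S \<noteq> {}"
  shows "0 \<le> spread S h"
  using norm_diff_le_spread[OF assms(1)] assms(2) by (metis ex_in_conv norm_ge_zero order_trans)

lemma norm_weighted_sum_diff_le_spread:
  fixes h :: "'s \<Rightarrow> 'a::real_normed_vector"
  assumes "finite S" "\<And>b. b \<in> S \<Longrightarrow> 0 \<le> p b" "\<And>b. b \<in> S \<Longrightarrow> 0 \<le> q b" "sum p S = 1" "sum q S = 1"
  shows "norm ((\<Sum>b\<in>S. p b *\<^sub>R h b) - (\<Sum>b\<in>S. q b *\<^sub>R h b)) \<le> spread S h"
  using norm_diff_weighted_sums_le[OF assms, of h "spread S h"] norm_diff_le_spread[OF assms(1), of _ _ h]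
  by simp

lemma norm_diff_weighted_sum_le_spread:
  fixes h :: "'s \<Rightarrow> 'a::real_normed_vector"
  assumes "finite S" "\<And>b. b \<in> S \<Longrightarrow> 0 \<le> q b" "sum q S = 1" "a \<in> S"
  shows "norm (h a - (\<Sum>b\<in>S. q b *\<^sub>R h b)) \<le> spread S h"
proof -
  have "(\<Sum>b\<in>S. (if a = b then 1 else 0) *\<^sub>R h b) = (\<Sum>b\<in>S. if a = b then h b else 0)"
    by (intro sum.cong) auto
  then show ?thesis
    using norm_weighted_sum_diff_le_spread[of S "\<lambda>b. if a = b then 1 else 0" q h] assms by simp
qed

text \<open>Doeblin's argument. Every row of the product over the window has at least
  \<open>\<eta>\<close> in column \<open>b0\<close>; this part contributes the same vector to all
  rows and cancels in differences, and the rest has row mass \<open>1 - \<eta>\<close>. The inputs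
  reach each of the two compared nodes, whence the factor 2.\<close>

lemma spread_contraction:
  fixes h u :: "nat \<Rightarrow> 's \<Rightarrow> 'a::real_normed_vector"
  assumes fin: "finite S" and b0: "b0 \<in> S"
    and nn: "\<And>k a b. 0 \<le> M k a b"
    and row: "\<And>k a. a \<in> S \<Longrightarrow> (\<Sum>b\<in>S. M k a b) = 1"
    and ev: "\<And>k a. a \<in> S \<Longrightarrow> h (Suc k) a = (\<Sum>b\<in>S. M k a b *\<^sub>R (h k b + u k b))"
    and U: "\<And>k b. b \<in> S \<Longrightarrow> norm (u k b) \<le> U k"
    and pos: "\<And>a. a \<in> S \<Longrightarrow> \<eta> \<le> mprod S M s K a b0"
  shows "spread S (h (s + K)) \<le> (1 - \<eta>) * spread S (h s) + 2 * (\<Sum>t<K. U (s + t))"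
proof -
  define P where "P = mprod S M s"
  define dev where "dev t a = h (s + t) a - (\<Sum>b\<in>S. P t a b *\<^sub>R h s b)" for t a
  have dev: "norm (dev t a) \<le> (\<Sum>r<t. U (s + r))" if "a \<in> S" for t a
    using that
  proof (induction t arbitrary: a)
    case 0
    have "(\<Sum>b\<in>S. P 0 a b *\<^sub>R h s b) = (\<Sum>b\<in>S. if a = b then h s b else 0)"
      unfolding P_def by (intro sum.cong) auto
    then show ?case using 0 fin by (simp add: dev_def)
  next
    case (Suc t)
    have "dev (Suc t) a = (\<Sum>c\<in>S. M (s + t) a c *\<^sub>R (dev t c + u (s + t) c))"
      unfolding dev_def P_def using ev Suc.prems by (intro mprod_deviation_Suc) auto
    also have "norm \<dots> \<le> (\<Sum>c\<in>S. M (s + t) a c * ((\<Sum>r<t. U (s + r)) + U (s + t)))"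
    proof (intro sum_norm_le)
      fix c assume c: "c \<in> S"
      have "norm (dev t c + u (s + t) c) \<le> (\<Sum>r<t. U (s + r)) + U (s + t)"
        using Suc.IH[OF c] U[OF c, of "s + t"] norm_triangle_ineq[of "dev t c" "u (s + t) c"] by linarith
      then show "norm (M (s + t) a c *\<^sub>R (dev t c + u (s + t) c))
          \<le> M (s + t) a c * ((\<Sum>r<t. U (s + r)) + U (s + t))"
        using nn by (simp add: mult_left_mono)
    qed
    also have "\<dots> = (\<Sum>r<Suc t. U (s + r))"
      using row[OF Suc.prems] by (simp add: sum_distrib_right[symmetric])
    finally show ?case .
  qed
  have Pnn: "0 \<le> P K a b" for a b unfolding P_def by (rule mprod_nonneg[OF nn])
  define Q where "Q a b = P K a b - (if b0 = b then \<eta> else 0)" for a b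
  have Qs: "(\<Sum>b\<in>S. Q a b) = 1 - \<eta>" if "a \<in> S" for a
    unfolding Q_def P_def using mprod_row_sum[OF fin row that] fin b0 by (simp add: sum_subtractf)
  have Qnn: "0 \<le> Q a b" if "a \<in> S" for a b
    using pos[OF that] Pnn[of a b] by (auto simp: Q_def P_def)
  have PQ: "(\<Sum>b\<in>S. P K a b *\<^sub>R h s b) = (\<Sum>b\<in>S. Q a b *\<^sub>R h s b) + \<eta> *\<^sub>R h s b0" for a
  proof -
    have "(\<Sum>b\<in>S. P K a b *\<^sub>R h s b)
        = (\<Sum>b\<in>S. Q a b *\<^sub>R h s b + (if b0 = b then \<eta> *\<^sub>R h s b else 0))"
      by (intro sum.cong) (auto simp: Q_def algebra_simps)
    then show ?thesis using fin b0 by (simp add: sum.distrib)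
  qed
  show ?thesis
  proof (rule spread_le[OF fin])
    show "S \<noteq> {}" using b0 by auto
    fix a b assume a: "a \<in> S" and b: "b \<in> S"
    have "norm ((\<Sum>c\<in>S. Q a c *\<^sub>R h s c) - (\<Sum>c\<in>S. Q b c *\<^sub>R h s c)) \<le> (1 - \<eta>) * spread S (h s)"
      using Qs Qnn a b norm_diff_le_spread[OF fin] fin by (intro norm_diff_weighted_sums_le) auto
    moreover have "h (s + K) a - h (s + K) b = (dev K a - dev K b)
        + ((\<Sum>c\<in>S. Q a c *\<^sub>R h s c) - (\<Sum>c\<in>S. Q b c *\<^sub>R h s c))"
      unfolding dev_def PQ by simp
    moreover have "norm (dev K a - dev K b) \<le> 2 * (\<Sum>t<K. U (s + t))"
      using dev[OF a, of K] dev[OF b, of K] norm_triangle_ineq4[of "dev K a" "dev K b"] by linarith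
    ultimately show "norm (h (s + K) a - h (s + K) b)
        \<le> (1 - \<eta>) * spread S (h s) + 2 * (\<Sum>t<K. U (s + t))"
      by (smt (verit) norm_triangle_ineq)
  qed
qed

section \<open>Contraction of the l1 norm under column-stochastic products\<close>

lemma l1_norm_matrix_apply_le:
  fixes e :: "'s \<Rightarrow> 'a::real_normed_vector"
  assumes "\<And>a b. a \<in> S \<Longrightarrow> b \<in> S \<Longrightarrow> 0 \<le> Q a b" "\<And>b. b \<in> S \<Longrightarrow> (\<Sum>a\<in>S. Q a b) = c"
  shows "(\<Sum>a\<in>S. norm (\<Sum>b\<in>S. Q a b *\<^sub>R e b)) \<le> c * (\<Sum>b\<in>S. norm (e b))"
proof -
  have "(\<Sum>a\<in>S. norm (\<Sum>b\<in>S. Q a b *\<^sub>R e b)) \<le> (\<Sum>a\<in>S. \<Sum>b\<in>S. Q a b * norm (e b))"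
    by (intro sum_mono sum_norm_le) (auto simp: assms)
  also have "\<dots> = (\<Sum>b\<in>S. (\<Sum>a\<in>S. Q a b) * norm (e b))"
    unfolding sum_distrib_right by (rule sum.swap)
  also have "\<dots> = c * (\<Sum>b\<in>S. norm (e b))"
    by (simp add: assms sum_distrib_left)
  finally show ?thesis .
qed

text \<open>The transposed Doeblin argument. Lowering row \<open>a0\<close> by \<open>\<eta>\<close>
  changes the image by \<open>\<eta>\<close> times the total of \<open>e s\<close>, which is zero,
  and leaves columns of mass \<open>1 - \<eta>\<close>. The recursion is assumed only before
  \<open>s + K\<close>, since a trajectory obeys the push recursion only below the horizon.\<close>

lemma l1_norm_contraction:
  fixes e u :: "nat \<Rightarrow> 's \<Rightarrow> 'a::real_normed_vector"
  assumes fin: "finite S" and a0: "a0 \<in> S"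
    and nn: "\<And>k a b. 0 \<le> M k a b"
    and col: "\<And>k b. b \<in> S \<Longrightarrow> (\<Sum>a\<in>S. M k a b) = 1"
    and ev: "\<And>k a. k < s + K \<Longrightarrow> a \<in> S \<Longrightarrow> e (Suc k) a = (\<Sum>b\<in>S. M k a b *\<^sub>R (e k b + u k b))"
    and U: "\<And>k. k < s + K \<Longrightarrow> (\<Sum>b\<in>S. norm (u k b)) \<le> U k"
    and zero: "(\<Sum>b\<in>S. e s b) = 0"
    and pos: "\<And>b. b \<in> S \<Longrightarrow> \<eta> \<le> mprod S M s K a0 b"
  shows "(\<Sum>a\<in>S. norm (e (s + K) a)) \<le> (1 - \<eta>) * (\<Sum>a\<in>S. norm (e s a)) + (\<Sum>t<K. U (s + t))"
proof -
  define P where "P = mprod S M s"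
  define dev where "dev t a = e (s + t) a - (\<Sum>b\<in>S. P t a b *\<^sub>R e s b)" for t a
  have dev: "(\<Sum>a\<in>S. norm (dev t a)) \<le> (\<Sum>r<t. U (s + r))" if "t \<le> K" for t
    using that
  proof (induction t)
    case 0
    have "(\<Sum>b\<in>S. P 0 a b *\<^sub>R e s b) = (\<Sum>b\<in>S. if a = b then e s b else 0)" for a
      unfolding P_def by (intro sum.cong) auto
    then show ?case using fin by (simp add: dev_def)
  next
    case (Suc t)
    have "(\<Sum>a\<in>S. norm (dev (Suc t) a))
        = (\<Sum>a\<in>S. norm (\<Sum>c\<in>S. M (s + t) a c *\<^sub>R (dev t c + u (s + t) c)))"
      unfolding dev_def P_def using ev Suc.prems
      by (intro sum.cong refl arg_cong[where f = norm] mprod_deviation_Suc) auto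
    also have "\<dots> \<le> 1 * (\<Sum>c\<in>S. norm (dev t c + u (s + t) c))"
      by (intro l1_norm_matrix_apply_le) (auto simp: nn col)
    also have "\<dots> \<le> (\<Sum>c\<in>S. norm (dev t c) + norm (u (s + t) c))"
      by (simp add: sum_mono norm_triangle_ineq)
    also have "\<dots> \<le> (\<Sum>r<t. U (s + r)) + U (s + t)"
      using Suc.IH U[of "s + t"] Suc.prems by (simp add: sum.distrib)
    finally show ?case by simp
  qed
  have Pnn: "0 \<le> P K a b" for a b unfolding P_def by (rule mprod_nonneg[OF nn])
  define Q where "Q a b = P K a b - (if a0 = a then \<eta> else 0)" for a b
  have Qs: "(\<Sum>a\<in>S. Q a b) = 1 - \<eta>" if "b \<in> S" for b
    unfolding Q_def P_def using mprod_col_sum[OF fin col that] fin a0 by (simp add: sum_subtractf)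
  have Qnn: "0 \<le> Q a b" if "b \<in> S" for a b
    using pos[OF that] Pnn[of a b] by (auto simp: Q_def P_def)
  have PQ: "(\<Sum>b\<in>S. P K a b *\<^sub>R e s b) = (\<Sum>b\<in>S. Q a b *\<^sub>R e s b)" for a
    unfolding Q_def using zero
    by (auto simp: scaleR_diff_left sum_subtractf scaleR_sum_right[symmetric])
  have "(\<Sum>a\<in>S. norm (e (s + K) a)) \<le> (\<Sum>a\<in>S. norm (\<Sum>b\<in>S. Q a b *\<^sub>R e s b) + norm (dev K a))"
    by (intro sum_mono) (metis PQ dev_def add_diff_cancel_left' diff_add_cancel add.commute norm_triangle_ineq)
  also have "\<dots> \<le> (1 - \<eta>) * (\<Sum>a\<in>S. norm (e s a)) + (\<Sum>t<K. U (s + t))"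
    unfolding sum.distrib using dev[of K] Qs Qnn
    by (intro add_mono l1_norm_matrix_apply_le) auto
  finally show ?thesis .
qed

subsection \<open>The delayed consensus system\<close>

text \<open>The read time \<open>\<tau>\<^sub>i\<^sub>j\<^sup>k\<^sup>-\<^sup>1\<close> truncated at \<open>0\<close>; nothing is lost because \<open>v\<close> and \<open>\<rho>\<close> vanish at all
  nonpositive times.\<close>

primrec stamp :: "('v \<times> 'v) set \<Rightarrow> (nat \<Rightarrow> 'v) \<Rightarrow> (nat \<Rightarrow> 'v \<Rightarrow> nat) \<Rightarrow> nat \<Rightarrow> 'v \<Rightarrow> 'v \<Rightarrow> nat" where
  "stamp E sched d 0 i j = 0"
| "stamp E sched d (Suc k) i j =
    (if i = sched k \<and> j \<in> Nin E i then max (stamp E sched d k i j) (k - d k j) else stamp E sched d k i j)"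

locale async_network =
  fixes E :: "('v::finite \<times> 'v) set" and W A :: "'v \<Rightarrow> 'v \<Rightarrow> real" and m :: real
    and T D :: nat and sched :: "nat \<Rightarrow> 'v" and d :: "nat \<Rightarrow> 'v \<Rightarrow> nat"
  assumes noloops: "(i, i) \<notin> E"
    and strongly_connected: "(i, j) \<in> E\<^sup>*"
    and m_pos: "0 < m" and m_less_1: "m < 1"
    and W: "row_stochastic W" "weight_pattern E m W"
    and A: "col_stochastic A" "weight_pattern E m A"
    and admissible: "admissible_schedule E T D sched d"
begin

abbreviation "\<theta> \<equiv> stamp E sched d"

lemma activation: "\<exists>t. k \<le> t \<and> t < k + T \<and> sched t = i"
  using admissible by (auto simp: admissible_schedule_def)

lemma stamp_le: "\<theta> k i j \<le> k"
  by (induction k) auto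

lemma stamp_Suc_le: "\<theta> (Suc k) i j \<le> k"
  using stamp_le[of k i j] by auto

lemma stamp_mono_Suc: "\<theta> k i j \<le> \<theta> (Suc k) i j"
  by simp

lemma stamp_ge: "(j, sched k) \<in> E \<Longrightarrow> k - D \<le> \<theta> (Suc k) (sched k) j"
  using admissible by (auto simp: admissible_schedule_def Nin_def le_max_iff_disj intro!: disjI2 diff_le_mono2)

lemma W_nonneg: "0 \<le> W i j" and W_sum: "(\<Sum>j\<in>UNIV. W i j) = 1"
  and W_diag: "m \<le> W i i" and W_edge: "(j, i) \<in> E \<Longrightarrow> m \<le> W i j"
  and W_zero: "i \<noteq> j \<Longrightarrow> (j, i) \<notin> E \<Longrightarrow> W i j = 0"
  using W by (auto simp: row_stochastic_def weight_pattern_def)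

lemma A_nonneg: "0 \<le> A i j" and A_sum: "(\<Sum>i\<in>UNIV. A i j) = 1"
  and A_diag: "m \<le> A i i" and A_edge: "(j, i) \<in> E \<Longrightarrow> m \<le> A i j"
  and A_zero: "i \<noteq> j \<Longrightarrow> (j, i) \<notin> E \<Longrightarrow> A i j = 0"
  using A by (auto simp: col_stochastic_def weight_pattern_def)

lemma m_power_antimono: "t \<le> t' \<Longrightarrow> m ^ t' \<le> m ^ t"
  using m_pos m_less_1 by (intro power_decreasing) auto

text \<open>Node \<open>(i, 0)\<close> carries \<open>x\<^sub>i\<^sup>k\<close> and node \<open>(i, Suc r)\<close> carries \<open>v\<^sub>i\<^sup>k\<^sup>-\<^sup>r\<close>.\<close>

definition lag :: "nat \<Rightarrow> 'v \<Rightarrow> nat" where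
  "lag k j = (if j = sched k then 0 else Suc (k - \<theta> (Suc k) (sched k) j))"

fun origin :: "nat \<Rightarrow> 'v \<times> nat \<Rightarrow> 'v \<times> nat" where
  "origin k (l, 0) = (l, 0)"
| "origin k (l, Suc 0) = (if l = sched k then (l, 0) else (l, Suc 0))"
| "origin k (l, Suc (Suc r)) = (l, Suc r)"

text \<open>Inputs are added before the matrix acts. With the input, node \<open>(i, 0)\<close> of
  the active agent holds \<open>v\<close> of time \<open>k + 1\<close>, and this is what both its
  own averaging step and its newest buffer slot have to read. Hence the lag 0 of the active agent
  and the middle case of \<open>origin\<close>.\<close>

definition mix :: "nat \<Rightarrow> 'v \<times> nat \<Rightarrow> 'v \<times> nat \<Rightarrow> real" where
  "mix k a b = (if a = (sched k, 0) then (if snd b = lag k (fst b) then W (sched k) (fst b) else 0)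
                else if b = origin k a then 1 else 0)"

abbreviation mix_nodes :: "('v \<times> nat) set" where
  "mix_nodes \<equiv> UNIV \<times> {..Suc D}"

lemma mix_nonneg: "0 \<le> mix k a b"
  by (simp add: mix_def W_nonneg)

lemma lag_le: "(j, sched k) \<in> E \<Longrightarrow> lag k j \<le> Suc D"
  using stamp_ge[of j k] by (auto simp: lag_def)

lemma origin_in: "a \<in> mix_nodes \<Longrightarrow> origin k a \<in> mix_nodes"
  by (cases "(k, a)" rule: origin.cases) auto

lemma mix_apply:
  fixes g :: "'v \<times> nat \<Rightarrow> 'a::real_vector"
  assumes "a \<in> mix_nodes"
  shows "(\<Sum>b\<in>mix_nodes. mix k a b *\<^sub>R g b) =
    (if a = (sched k, 0) then (\<Sum>j\<in>UNIV. W (sched k) j *\<^sub>R g (j, lag k j)) else g (origin k a))"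
proof (cases "a = (sched k, 0)")
  case True
  have "(\<Sum>b\<in>mix_nodes. mix k a b *\<^sub>R g b)
      = (\<Sum>j\<in>UNIV. \<Sum>r\<in>{..Suc D}. if r = lag k j then W (sched k) j *\<^sub>R g (j, r) else 0)"
    unfolding sum.cartesian_product using True by (intro sum.cong) (auto simp: mix_def)
  also have "\<dots> = (\<Sum>j\<in>UNIV. W (sched k) j *\<^sub>R g (j, lag k j))"
  proof (intro sum.cong refl)
    fix j
    show "(\<Sum>r\<in>{..Suc D}. if r = lag k j then W (sched k) j *\<^sub>R g (j, r) else 0)
        = W (sched k) j *\<^sub>R g (j, lag k j)"
    proof (cases "lag k j \<le> Suc D")
      case True
      then show ?thesis by simp
    next
      case False
      \<comment> \<open>A lag beyond the buffer can occur only for a non-neighbour, where the weight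
        vanishes.\<close>
      then have "W (sched k) j = 0"
        using lag_le[of j k] W_zero[of "sched k" j] by (auto simp: lag_def split: if_splits)
      then show ?thesis by simp
    qed
  qed
  finally show ?thesis using True by simp
next
  case False
  then have "(\<Sum>b\<in>mix_nodes. mix k a b *\<^sub>R g b) = (\<Sum>b\<in>mix_nodes. if b = origin k a then g b else 0)"
    by (intro sum.cong) (auto simp: mix_def)
  then show ?thesis using False origin_in[OF assms] by (simp del: atMost_Suc)
qed

lemma mix_row_sum: "a \<in> mix_nodes \<Longrightarrow> (\<Sum>b\<in>mix_nodes. mix k a b) = 1"
  using mix_apply[of a k "\<lambda>_. 1::real"] W_sum by simp

section \<open>Positive columns of the mixing products\<close>

text \<open>An orbit stands for a column of \<open>mprod mix_nodes mix s\<close>. Its lower bounds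
  have the form \<open>m ^ t\<close> at local time \<open>t\<close>: a step costs at most one factor
  \<open>m\<close>, so that waiting, copying and averaging need no separate count.\<close>

definition mix_orbit :: "nat \<Rightarrow> (nat \<Rightarrow> 'v \<times> nat \<Rightarrow> real) \<Rightarrow> bool" where
  "mix_orbit s \<phi> \<longleftrightarrow> (\<forall>t a. 0 \<le> \<phi> t a) \<and>
    (\<forall>t. \<forall>a\<in>mix_nodes. \<phi> (Suc t) a = (\<Sum>b\<in>mix_nodes. mix (s + t) a b * \<phi> t b))"

lemma mix_orbit_nonneg: "mix_orbit s \<phi> \<Longrightarrow> 0 \<le> \<phi> t a"
  unfolding mix_orbit_def by blast

lemma mix_orbit_Suc:
  assumes "mix_orbit s \<phi>" "a \<in> mix_nodes"
  shows "\<phi> (Suc t) a = (if a = (sched (s + t), 0)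
    then (\<Sum>j\<in>UNIV. W (sched (s + t)) j * \<phi> t (j, lag (s + t) j)) else \<phi> t (origin (s + t) a))"
proof -
  have "\<phi> (Suc t) a = (\<Sum>b\<in>mix_nodes. mix (s + t) a b *\<^sub>R \<phi> t b)"
    using assms unfolding mix_orbit_def real_scaleR_def by blast
  then show ?thesis using mix_apply[OF assms(2), of "s + t" "\<phi> t"] by simp
qed

lemma mix_orbit_receive:
  assumes o: "mix_orbit s \<phi>" and w: "m \<le> W (sched (s + t)) j"
    and p: "m ^ t \<le> \<phi> t (j, lag (s + t) j)"
  shows "m ^ Suc t \<le> \<phi> (Suc t) (sched (s + t), 0)"
proof -
  note nn = mix_orbit_nonneg[OF o, of t]
  have "m ^ Suc t \<le> W (sched (s + t)) j * \<phi> t (j, lag (s + t) j)"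
    using w p m_pos nn by (auto intro!: mult_mono)
  also have "\<dots> \<le> (\<Sum>j\<in>UNIV. W (sched (s + t)) j * \<phi> t (j, lag (s + t) j))"
    by (rule member_le_sum) (auto simp: W_nonneg nn)
  finally show ?thesis using mix_orbit_Suc[OF o, of "(sched (s + t), 0)" t] by simp
qed

lemma mix_orbit_persist:
  assumes o: "mix_orbit s \<phi>" and p: "m ^ t0 \<le> \<phi> t0 (l, 0)" and t: "t0 \<le> t"
  shows "m ^ t \<le> \<phi> t (l, 0)"
  using t
proof (induction t rule: dec_induct)
  case base
  then show ?case by (rule p)
next
  case (step t)
  show ?case
  proof (cases "l = sched (s + t)")
    case True
    then show ?thesis
      using mix_orbit_receive[OF o W_diag, of t] step by (simp add: lag_def)
  next
    case False
    then show ?thesis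
      using mix_orbit_Suc[OF o, of "(l, 0)" t] step m_power_antimono[of t "Suc t"] by auto
  qed
qed

text \<open>Within \<open>T\<close> steps agent \<open>l\<close> is active and its value enters slot
  \<open>Suc 0\<close>, which afterwards is either kept or reloaded from \<open>(l, 0)\<close>.
  Reaching slot \<open>Suc r\<close> takes \<open>r\<close> further steps, at most
  \<open>D\<close>.\<close>

lemma mix_orbit_window:
  assumes o: "mix_orbit s \<phi>" and p: "\<And>t. t0 \<le> t \<Longrightarrow> m ^ t \<le> \<phi> t (l, 0)"
    and t: "t0 + T + D \<le> t" and r: "r \<le> D"
  shows "m ^ t \<le> \<phi> t (l, Suc r)"
proof -
  obtain t1 where t1: "t0 \<le> t1" "t1 < t0 + T" "sched (s + t1) = l"
    using activation[of "s + t0" l] by (metis le_add_diff_inverse add.assoc add_le_cancel_left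
        nat_add_left_cancel_less le_iff_add)
  have head: "m ^ t \<le> \<phi> t (l, Suc 0)" if "Suc t1 \<le> t" for t
    using that
  proof (induction t rule: dec_induct)
    case base
    then show ?case
      using mix_orbit_Suc[OF o, of "(l, Suc 0)" t1] t1 p[of t1] m_power_antimono[of t1 "Suc t1"] by auto
  next
    case (step t)
    then show ?case
      using mix_orbit_Suc[OF o, of "(l, Suc 0)" t] t1 p[of t] m_power_antimono[of t "Suc t"] by auto
  qed
  have "m ^ t \<le> \<phi> t (l, Suc r)" if "Suc t1 + r \<le> t" "r \<le> D" for t r
    using that
  proof (induction r arbitrary: t)
    case 0
    then show ?case using head by simp
  next
    case (Suc r)
    then obtain t' where t': "t = Suc t'" by (cases t) auto
    have "m ^ t' \<le> \<phi> t' (l, Suc r)" using Suc t' by auto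
    then show ?case
      using mix_orbit_Suc[OF o, of "(l, Suc (Suc r))" t'] Suc.prems t' m_power_antimono[of t' t] by auto
  qed
  then show ?thesis using t t1 r by auto
qed

text \<open>Induction along a path. An edge from \<open>j\<close> to \<open>l\<close> costs at most
  \<open>2 * T + D\<close> steps: \<open>T + D\<close> until every slot of \<open>j\<close> that
  \<open>l\<close> may read is filled, then up to \<open>T\<close> until \<open>l\<close> is active.
  The threshold is chosen before \<open>s\<close> and the orbit, so it is uniform in the starting
  time.\<close>

lemma mix_orbit_spreads:
  assumes "(l0, l) \<in> E\<^sup>*"
  shows "\<exists>t0. \<forall>s \<phi>. mix_orbit s \<phi> \<and> 1 \<le> \<phi> 0 (l0, 0) \<longrightarrow> (\<forall>t\<ge>t0. m ^ t \<le> \<phi> t (l, 0))"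
  using assms
proof (induction rule: rtrancl_induct)
  case base
  show ?case
    by (intro exI[of _ 0] allI impI) (rule mix_orbit_persist[where ?t0.0 = 0], auto)
next
  case (step j l)
  then obtain t0 where t0: "\<And>s \<phi> t. mix_orbit s \<phi> \<Longrightarrow> 1 \<le> \<phi> 0 (l0, 0) \<Longrightarrow> t0 \<le> t \<Longrightarrow> m ^ t \<le> \<phi> t (j, 0)"
    by blast
  have "m ^ t \<le> \<phi> t (l, 0)" if o: "mix_orbit s \<phi>" and i: "1 \<le> \<phi> 0 (l0, 0)" and t: "t0 + 2 * T + D \<le> t" for s \<phi> t
  proof -
    obtain t1 where t1: "t0 + T + D \<le> t1" "t1 < t0 + T + D + T" "sched (s + t1) = l"
      using activation[of "s + (t0 + T + D)" l] by (metis le_add_diff_inverse add.assoc add_le_cancel_left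
        nat_add_left_cancel_less le_iff_add)
    have jl: "j \<noteq> l" using step.hyps noloops by auto
    have "lag (s + t1) j \<le> Suc D" using lag_le[of j "s + t1"] step.hyps t1 by auto
    then have "m ^ t1 \<le> \<phi> t1 (j, lag (s + t1) j)"
      using mix_orbit_window[OF o t0[OF o i] t1(1)] jl t1(3) by (auto simp: lag_def)
    then have "m ^ Suc t1 \<le> \<phi> (Suc t1) (l, 0)"
      using mix_orbit_receive[OF o, of t1 j] W_edge[OF step.hyps(2)] t1(3) by simp
    then show ?thesis by (rule mix_orbit_persist[OF o]) (use t t1 in auto)
  qed
  then show ?case by blast
qed

text \<open>Finitely many pairs of agents give one threshold for the rows \<open>(j, 0)\<close>; the
  rows of the buffer slots follow \<open>T + D\<close> steps later.\<close>

lemma mix_positive: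
  "\<exists>t0. \<forall>t\<ge>t0. \<forall>s l. \<forall>a\<in>mix_nodes. m ^ t \<le> mprod mix_nodes mix s t a (l, 0)"
proof -
  have "\<forall>p. \<exists>t0. \<forall>s \<phi>. mix_orbit s \<phi> \<and> 1 \<le> \<phi> 0 (fst p, 0) \<longrightarrow> (\<forall>t\<ge>t0. m ^ t \<le> \<phi> t (snd p, 0))"
    using mix_orbit_spreads strongly_connected by blast
  then obtain c where c: "\<And>p s \<phi> t. mix_orbit s \<phi> \<Longrightarrow> 1 \<le> \<phi> 0 (fst p, 0) \<Longrightarrow> c p \<le> t \<Longrightarrow> m ^ t \<le> \<phi> t (snd p, 0)"
    by metis
  define t0 where "t0 = Max (range c)"
  have ct: "c p \<le> t0" for p unfolding t0_def by (intro Max_ge) auto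
  have "m ^ t \<le> mprod mix_nodes mix s t (j, r) (l, 0)" if t: "t0 + T + D \<le> t" and r: "r \<le> Suc D" for t s l j r
  proof -
    define \<phi> where "\<phi> t a = mprod mix_nodes mix s t a (l, 0)" for t a
    have o: "mix_orbit s \<phi>"
      unfolding mix_orbit_def \<phi>_def using mprod_nonneg[of mix, OF mix_nonneg] by simp
    have x: "m ^ t \<le> \<phi> t (j, 0)" if "t0 \<le> t" for t
      using c[OF o, of "(l, j)" t] ct[of "(l, j)"] that by (simp add: \<phi>_def)
    have "m ^ t \<le> \<phi> t (j, r)"
    proof (cases r)
      case 0
      then show ?thesis using x t by auto
    next
      case (Suc r')
      then show ?thesis using mix_orbit_window[OF o x t, of r'] r by auto
    qed
    then show ?thesis by (simp add: \<phi>_def)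
  qed
  then show ?thesis by (intro exI[of _ "t0 + T + D"]) (auto simp del: atMost_Suc)
qed

subsection \<open>The delayed push system\<close>

text \<open>Node \<open>Inl i\<close> carries \<open>z\<^sub>i\<close> and node \<open>Inr (i, j, s)\<close> the packet that \<open>j\<close> sent to \<open>i\<close> in iteration
  \<open>s - 1\<close>, as long as \<open>i\<close> has not read it. Labels \<open>s > k\<close> are empty at time \<open>k\<close> in a real trajectory;
  letting the receiver empty them too makes mass reach a tracker in bounded time from every node.
  Capping new labels at the horizon \<open>N\<close> keeps the matrices column-stochastic for all \<open>k\<close>.\<close>

definition push_nodes :: "nat \<Rightarrow> ('v + 'v \<times> 'v \<times> nat) set" where
  "push_nodes N = UNIV <+> {(i, j, s). (j, i) \<in> E \<and> s \<le> N}"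

definition taken :: "nat \<Rightarrow> 'v + 'v \<times> 'v \<times> nat \<Rightarrow> bool" where
  "taken k b = (case b of Inl l \<Rightarrow> l = sched k
     | Inr (l, j, s) \<Rightarrow> l = sched k \<and> (s \<le> \<theta> (Suc k) l j \<or> k < s))"

definition share :: "nat \<Rightarrow> nat \<Rightarrow> 'v + 'v \<times> 'v \<times> nat \<Rightarrow> real" where
  "share N k a = (case a of Inl l \<Rightarrow> if l = sched k then A l l else 0
     | Inr (l, j, s) \<Rightarrow> if j = sched k \<and> s = min (Suc k) N then A l j else 0)"

text \<open>All taken columns coincide: the active agent pools what it takes into one sum and
  redistributes this sum by its column of \<open>A\<close>.\<close>

definition push :: "nat \<Rightarrow> nat \<Rightarrow> 'v + 'v \<times> 'v \<times> nat \<Rightarrow> 'v + 'v \<times> 'v \<times> nat \<Rightarrow> real" where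
  "push N k a b = (if taken k b then share N k a else if a = b then 1 else 0)"

lemma finite_packets: "finite {(i, j, s). (j, i) \<in> E \<and> s \<le> (N::nat)}"
  by (rule finite_subset[of _ "UNIV \<times> UNIV \<times> {..N}"]) auto

lemma finite_push_nodes: "finite (push_nodes N)"
  unfolding push_nodes_def using finite_packets by simp

lemma Inl_in_push_nodes [simp]: "Inl i \<in> push_nodes N"
  by (auto simp: push_nodes_def)

lemma Inr_in_push_nodes [simp]: "Inr (i, j, s) \<in> push_nodes N \<longleftrightarrow> (j, i) \<in> E \<and> s \<le> N"
  by (auto simp: push_nodes_def)

lemma share_nonneg: "0 \<le> share N k a"
  by (auto simp: share_def A_nonneg split: sum.splits)

lemma push_nonneg: "0 \<le> push N k a b"
  by (simp add: push_def share_nonneg)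

lemma sum_packets:
  fixes g :: "'v \<Rightarrow> 'v \<Rightarrow> nat \<Rightarrow> 'b::comm_monoid_add"
  shows "(\<Sum>(i, j, s)\<in>{(i, j, s). (j, i) \<in> E \<and> s \<le> N}. g i j s)
    = (\<Sum>i\<in>UNIV. \<Sum>j\<in>Nin E i. \<Sum>s\<le>N. g i j s)"
proof -
  have "{(i, j, s). (j, i) \<in> E \<and> s \<le> N} = (SIGMA i:UNIV. Nin E i \<times> {..N})"
    by (auto simp: Nin_def)
  then show ?thesis
    by (simp add: sum.Sigma[symmetric] sum.cartesian_product[symmetric])
qed

lemma share_sum: "(\<Sum>a\<in>push_nodes N. share N k a) = 1"
proof -
  have "(\<Sum>a\<in>push_nodes N. share N k a) = (\<Sum>l\<in>UNIV. if l = sched k then A l l else 0)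
     + (\<Sum>(l, j, s)\<in>{(i, j, s). (j, i) \<in> E \<and> s \<le> N}. if j = sched k \<and> s = min (Suc k) N then A l j else 0)"
    unfolding push_nodes_def
    by (subst sum.Plus[OF finite finite_packets]) (simp add: share_def o_def case_prod_unfold)
  also have "(\<Sum>(l, j, s)\<in>{(i, j, s). (j, i) \<in> E \<and> s \<le> N}. if j = sched k \<and> s = min (Suc k) N then A l j else 0)
     = (\<Sum>l\<in>UNIV. \<Sum>j\<in>Nin E l. if j = sched k then A l j else 0)"
  proof -
    have "(\<Sum>s\<le>N. if j = sched k \<and> s = min (Suc k) N then A l j else 0)
        = (if j = sched k then A l j else 0)" for l j
      by simp
    then show ?thesis unfolding sum_packets by simp
  qed
  also have "\<dots> = (\<Sum>l\<in>UNIV. if l = sched k then 0 else A l (sched k))"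
  proof (intro sum.cong refl)
    fix l
    have "(\<Sum>j\<in>Nin E l. if j = sched k then A l j else 0) = (if sched k \<in> Nin E l then A l (sched k) else 0)"
      by simp
    also have "\<dots> = (if l = sched k then 0 else A l (sched k))"
      using noloops A_zero[of l "sched k"] by (auto simp: Nin_def)
    finally show "(\<Sum>j\<in>Nin E l. if j = sched k then A l j else 0) = (if l = sched k then 0 else A l (sched k))" .
  qed
  also have "(\<Sum>l\<in>UNIV. if l = sched k then A l l else 0) + \<dots> = (\<Sum>l\<in>UNIV. A l (sched k))"
    unfolding sum.distrib[symmetric] by (intro sum.cong) auto
  finally show ?thesis using A_sum by simp
qed

lemma push_col_sum: "b \<in> push_nodes N \<Longrightarrow> (\<Sum>a\<in>push_nodes N. push N k a b) = 1"
  by (cases "taken k b") (simp_all add: push_def share_sum finite_push_nodes)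

lemma push_apply:
  fixes g :: "'v + 'v \<times> 'v \<times> nat \<Rightarrow> 'a::real_vector"
  assumes "a \<in> push_nodes N"
  shows "(\<Sum>b\<in>push_nodes N. push N k a b *\<^sub>R g b)
    = share N k a *\<^sub>R (\<Sum>b\<in>{b\<in>push_nodes N. taken k b}. g b) + (if taken k a then 0 else g a)"
proof -
  have "(\<Sum>b\<in>push_nodes N. push N k a b *\<^sub>R g b)
      = (\<Sum>b\<in>push_nodes N. (if taken k b then share N k a *\<^sub>R g b else 0)
          + (if a = b then (if taken k a then 0 else g a) else 0))"
    by (intro sum.cong) (auto simp: push_def)
  also have "\<dots> = (\<Sum>b\<in>{b\<in>push_nodes N. taken k b}. share N k a *\<^sub>R g b) + (if taken k a then 0 else g a)"
    unfolding sum.distrib using assms finite_push_nodes by (simp add: sum.inter_filter)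
  finally show ?thesis by (simp add: scaleR_sum_right)
qed

section \<open>Positive rows of the push products\<close>

definition push_orbit :: "nat \<Rightarrow> nat \<Rightarrow> (nat \<Rightarrow> 'v + 'v \<times> 'v \<times> nat \<Rightarrow> real) \<Rightarrow> bool" where
  "push_orbit N s \<phi> \<longleftrightarrow> (\<forall>t a. 0 \<le> \<phi> t a) \<and>
    (\<forall>t. \<forall>a\<in>push_nodes N. \<phi> (Suc t) a = (\<Sum>b\<in>push_nodes N. push N (s + t) a b * \<phi> t b))"

lemma push_orbit_nonneg: "push_orbit N s \<phi> \<Longrightarrow> 0 \<le> \<phi> t a"
  unfolding push_orbit_def by blast

lemma push_orbit_Suc:
  assumes "push_orbit N s \<phi>" "a \<in> push_nodes N"
  shows "\<phi> (Suc t) a = share N (s + t) a * (\<Sum>b\<in>{b\<in>push_nodes N. taken (s + t) b}. \<phi> t b)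
    + (if taken (s + t) a then 0 else \<phi> t a)"
proof -
  have "\<phi> (Suc t) a = (\<Sum>b\<in>push_nodes N. push N (s + t) a b *\<^sub>R \<phi> t b)"
    using assms unfolding push_orbit_def real_scaleR_def by blast
  then show ?thesis using push_apply[OF assms(2), of "s + t" "\<phi> t"] by simp
qed

lemma push_orbit_transfer:
  assumes o: "push_orbit N s \<phi>" and a: "a \<in> push_nodes N" and b: "b \<in> push_nodes N" "taken (s + t) b"
    and w: "m \<le> share N (s + t) a" and p: "m ^ t \<le> \<phi> t b"
  shows "m ^ Suc t \<le> \<phi> (Suc t) a"
proof -
  note nn = push_orbit_nonneg[OF o, of t]
  have "\<phi> t b \<le> (\<Sum>b\<in>{b\<in>push_nodes N. taken (s + t) b}. \<phi> t b)"
    using b by (intro member_le_sum) (auto simp: nn finite_push_nodes)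
  then have "m ^ Suc t \<le> share N (s + t) a * (\<Sum>b\<in>{b\<in>push_nodes N. taken (s + t) b}. \<phi> t b)"
    using w p m_pos nn share_nonneg by (auto intro!: mult_mono)
  then show ?thesis unfolding push_orbit_Suc[OF o a, of t] using nn[of a] by auto
qed

lemma push_orbit_keep:
  assumes o: "push_orbit N s \<phi>" and a: "a \<in> push_nodes N" "\<not> taken (s + t) a"
    and p: "m ^ t \<le> \<phi> t a"
  shows "m ^ Suc t \<le> \<phi> (Suc t) a"
proof -
  have "0 \<le> share N (s + t) a * (\<Sum>b\<in>{b\<in>push_nodes N. taken (s + t) b}. \<phi> t b)"
    by (intro mult_nonneg_nonneg sum_nonneg share_nonneg push_orbit_nonneg[OF o])
  then show ?thesis
    unfolding push_orbit_Suc[OF o a(1), of t] using a(2) p m_power_antimono[of t "Suc t"] by simp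
qed

lemma push_orbit_persist:
  assumes o: "push_orbit N s \<phi>" and p: "m ^ t0 \<le> \<phi> t0 (Inl l)" and t: "t0 \<le> t"
  shows "m ^ t \<le> \<phi> t (Inl l)"
  using t
proof (induction t rule: dec_induct)
  case base
  then show ?case by (rule p)
next
  case (step t)
  show ?case
  proof (cases "l = sched (s + t)")
    case True
    then show ?thesis
      using step A_diag by (intro push_orbit_transfer[OF o, of _ "Inl l"]) (auto simp: taken_def share_def)
  next
    case False
    then show ?thesis
      using step by (intro push_orbit_keep[OF o]) (auto simp: taken_def)
  qed
qed

text \<open>A label \<open>r \<le> s + t1 + T\<close> is covered by the stamp at any activation of
  \<open>i\<close> from \<open>s + t1 + T + D\<close> on, by the delay bound. A larger label still
  lies in the future at an activation before \<open>s + t1 + T\<close> and is emptied there.\<close>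

lemma packet_taken:
  assumes "(j, i) \<in> E"
  shows "\<exists>t. t1 \<le> t \<and> t < t1 + 2 * T + D \<and> taken (s + t) (Inr (i, j, r))"
proof (cases "r \<le> s + t1 + T")
  case True
  obtain k where k: "s + t1 + T + D \<le> k" "k < s + t1 + T + D + T" "sched k = i"
    using activation by blast
  have "r \<le> \<theta> (Suc k) i j" using stamp_ge[of j k] assms k True by auto
  then show ?thesis
    using k by (intro exI[of _ "k - s"]) (auto simp: taken_def)
next
  case False
  obtain k where k: "s + t1 \<le> k" "k < s + t1 + T" "sched k = i"
    using activation by blast
  then show ?thesis
    using False by (intro exI[of _ "k - s"]) (auto simp: taken_def)
qed

text \<open>A packet keeps its mass up to the first time it is taken, which
  \<open>packet_taken\<close> bounds. The receiver then retains the fraction \<open>A i i\<close> of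
  it, and its tracker persists.\<close>

lemma push_orbit_deliver:
  assumes o: "push_orbit N s \<phi>" and b: "Inr (i, j, r) \<in> push_nodes N" 
    and p: "m ^ t1 \<le> \<phi> t1 (Inr (i, j, r))" and t: "t1 + 2 * T + D \<le> t"
  shows "m ^ t \<le> \<phi> t (Inl i)"
proof -
  define ready where "ready t \<longleftrightarrow> t1 \<le> t \<and> taken (s + t) (Inr (i, j, r))" for t
  define t2 where "t2 = Least ready"
  obtain t3 where t3: "ready t3" "t3 < t1 + 2 * T + D"
    using packet_taken[of j i t1 s r] b by (auto simp: ready_def)
  have "ready t2" unfolding t2_def by (rule LeastI) (rule t3)
  then have t2: "t1 \<le> t2" "taken (s + t2) (Inr (i, j, r))" by (auto simp: ready_def)
  have le: "t2 \<le> t3" unfolding t2_def by (rule Least_le) (rule t3)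
  have nt: "\<not> taken (s + t) (Inr (i, j, r))" if "t1 \<le> t" "t < t2" for t
  proof -
    have "\<not> ready t" using that(2) unfolding t2_def by (rule not_less_Least)
    then show ?thesis using that(1) by (simp add: ready_def)
  qed
  have "m ^ t \<le> \<phi> t (Inr (i, j, r))" if "t1 \<le> t" "t \<le> t2" for t
    using that
  proof (induction t rule: dec_induct)
    case base
    show ?case by (rule p)
  next
    case (step t)
    then show ?case using nt[of t] by (intro push_orbit_keep[OF o b]) auto
  qed
  then have "m ^ t2 \<le> \<phi> t2 (Inr (i, j, r))" using t2 by auto
  then have "m ^ Suc t2 \<le> \<phi> (Suc t2) (Inl i)"
    using t2 b A_diag by (intro push_orbit_transfer[OF o _ b]) (auto simp: taken_def share_def)
  then show ?thesis
    by (rule push_orbit_persist[OF o]) (use t le t3 in auto)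
qed

text \<open>An edge costs at most \<open>3 * T + D\<close> steps: up to \<open>T\<close> until
  \<open>j\<close> is active and sends, then \<open>2 * T + D\<close> for delivery. The constant is
  uniform in the horizon, and the start \<open>t0\<close> is arbitrary because mass may reach its
  first tracker only after a delivery.\<close>

lemma push_orbit_spreads:
  assumes "(l0, l) \<in> E\<^sup>*"
  shows "\<exists>c. \<forall>N s \<phi> t0. push_orbit N s \<phi> \<and> m ^ t0 \<le> \<phi> t0 (Inl l0) \<longrightarrow> (\<forall>t\<ge>t0 + c. m ^ t \<le> \<phi> t (Inl l))"
  using assms
proof (induction rule: rtrancl_induct)
  case base
  show ?case
    by (intro exI[of _ 0] allI impI) (rule push_orbit_persist, auto)
next
  case (step j l)
  then obtain c where c: "\<And>N s \<phi> t0 t. push_orbit N s \<phi> \<Longrightarrow> m ^ t0 \<le> \<phi> t0 (Inl l0) \<Longrightarrow> t0 + c \<le> t \<Longrightarrow> m ^ t \<le> \<phi> t (Inl j)"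
    by blast
  have "m ^ t \<le> \<phi> t (Inl l)" if o: "push_orbit N s \<phi>" and i: "m ^ t0 \<le> \<phi> t0 (Inl l0)"
    and t: "t0 + (c + T + 2 * T + D) \<le> t" for N s \<phi> t0 t
  proof -
    obtain k where k: "s + t0 + c \<le> k" "k < s + t0 + c + T" "sched k = j"
      using activation by blast
    define t1 where "t1 = k - s"
    have t1: "t0 + c \<le> t1" "t1 < t0 + c + T" "sched (s + t1) = j" using k by (auto simp: t1_def)
    have b: "Inr (l, j, min (Suc (s + t1)) N) \<in> push_nodes N"
      using step.hyps by simp
    have "m ^ Suc t1 \<le> \<phi> (Suc t1) (Inr (l, j, min (Suc (s + t1)) N))"
      using c[OF o i t1(1)] t1(3) A_edge[OF step.hyps(2)]
      by (intro push_orbit_transfer[OF o b, of "Inl j"]) (auto simp: taken_def share_def)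
    then show ?thesis
      by (rule push_orbit_deliver[OF o b]) (use t t1 in auto)
  qed
  then show ?case by blast
qed

text \<open>The first \<open>2 * T + D\<close> steps bring the mass of any packet into the tracker
  of its receiver; from there it follows paths of the graph.\<close>

lemma push_positive:
  "\<exists>c. \<forall>t\<ge>c. \<forall>N s l. \<forall>b\<in>push_nodes N. m ^ t \<le> mprod (push_nodes N) (push N) s t (Inl l) b"
proof -
  have "\<forall>p. \<exists>c. \<forall>N s \<phi> t0. push_orbit N s \<phi> \<and> m ^ t0 \<le> \<phi> t0 (Inl (fst p)) \<longrightarrow> (\<forall>t\<ge>t0 + c. m ^ t \<le> \<phi> t (Inl (snd p)))"
    using push_orbit_spreads strongly_connected by blast
  then obtain c where c: "\<And>p N s \<phi> t0 t. push_orbit N s \<phi> \<Longrightarrow> m ^ t0 \<le> \<phi> t0 (Inl (fst p)) \<Longrightarrow> t0 + c p \<le> t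
      \<Longrightarrow> m ^ t \<le> \<phi> t (Inl (snd p))"
    by metis
  define t0 where "t0 = Max (range c)"
  have ct: "c p \<le> t0" for p unfolding t0_def by (intro Max_ge) auto
  have "m ^ t \<le> mprod (push_nodes N) (push N) s t (Inl l) b"
    if t: "2 * T + D + t0 \<le> t" and b: "b \<in> push_nodes N" for t N s l b
  proof -
    define \<phi> where "\<phi> t a = mprod (push_nodes N) (push N) s t a b" for t a
    have o: "push_orbit N s \<phi>"
      unfolding push_orbit_def \<phi>_def using mprod_nonneg[of "push N", OF push_nonneg] by simp
    have b0: "m ^ 0 \<le> \<phi> 0 b" by (simp add: \<phi>_def)
    have "\<exists>i. m ^ (2 * T + D) \<le> \<phi> (2 * T + D) (Inl i)"
    proof (cases b)
      case (Inl i)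
      then show ?thesis using push_orbit_persist[OF o, of 0 i "2 * T + D"] b0 by auto
    next
      case (Inr p)
      then show ?thesis using push_orbit_deliver[OF o, of _ _ _ 0 "2 * T + D"] b0 b
        by (cases p) (auto intro!: exI[of _ "fst p"])
    qed
    then obtain i where "m ^ (2 * T + D) \<le> \<phi> (2 * T + D) (Inl i)" by blast
    then have "m ^ t \<le> \<phi> t (Inl l)"
      using c[OF o, of "2 * T + D" "(i, l)" t] ct[of "(i, l)"] t by auto
    then show ?thesis by (simp add: \<phi>_def)
  qed
  then show ?thesis by (intro exI[of _ "2 * T + D + t0"]) auto
qed

text \<open>Both lower bounds hold for all large \<open>t\<close>, so one window length
  \<open>K\<close> with \<open>\<eta> = m ^ K\<close> serves both systems, all starting times and
  all horizons.\<close>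

lemma uniform_positivity:
  obtains K \<eta> where "0 < K" "0 < \<eta>" "\<eta> \<le> 1"
    "\<And>s l a. a \<in> mix_nodes \<Longrightarrow> \<eta> \<le> mprod mix_nodes mix s K a (l, 0)"
    "\<And>N s l b. b \<in> push_nodes N \<Longrightarrow> \<eta> \<le> mprod (push_nodes N) (push N) s K (Inl l) b"
proof -
  obtain t1 where t1: "\<And>t s l a. t1 \<le> t \<Longrightarrow> a \<in> mix_nodes \<Longrightarrow> m ^ t \<le> mprod mix_nodes mix s t a (l, 0)"
    using mix_positive by blast
  obtain t2 where t2: "\<And>t N s l b. t2 \<le> t \<Longrightarrow> b \<in> push_nodes N \<Longrightarrow> m ^ t \<le> mprod (push_nodes N) (push N) s t (Inl l) b"
    using push_positive by blast
  define K where "K = Suc (t1 + t2)"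
  show ?thesis
  proof (rule that[of K "m ^ K"])
    show "m ^ K \<le> 1" using m_pos m_less_1 by (intro power_le_one) auto
  qed (use m_pos t1[of K] t2[of K] in \<open>auto simp: K_def\<close>)
qed

end

subsection \<open>Trajectories as solutions of the augmented systems\<close>

locale sonata_run = async_network E W A m T D sched d
  for E :: "('v::finite \<times> 'v) set" and W A m T D sched d +
  fixes grad :: "'v \<Rightarrow> 'a::euclidean_space \<Rightarrow> 'a" and \<gamma> :: real
    and x z :: "nat \<Rightarrow> 'v \<Rightarrow> 'a" and v :: "int \<Rightarrow> 'v \<Rightarrow> 'a"
    and rho :: "int \<Rightarrow> 'v \<Rightarrow> 'v \<Rightarrow> 'a" and rt :: "nat \<Rightarrow> 'v \<Rightarrow> 'v \<Rightarrow> 'a"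
    and tau :: "int \<Rightarrow> 'v \<Rightarrow> 'v \<Rightarrow> int"
  assumes run: "asy_sonata E W A grad D \<gamma> sched d x z v rho rt tau"
begin

lemma init: "z 0 i = grad i (x 0 i)" "rt 0 i j = 0" "tau (-1) i j = - int D"
  "- int D \<le> t \<Longrightarrow> t \<le> 0 \<Longrightarrow> rho t i j = 0" "- int D \<le> t \<Longrightarrow> t \<le> 0 \<Longrightarrow> v t i = 0"
  using run unfolding asy_sonata_def by auto

definition zhalf :: "nat \<Rightarrow> 'a" where
  "zhalf k = z k (sched k) + (\<Sum>j\<in>Nin E (sched k). rho (tau (int k) (sched k) j) (sched k) j - rt k (sched k) j)
     + grad (sched k) (x (Suc k) (sched k)) - grad (sched k) (x k (sched k))"

lemma step:
  "tau (int k) i j = (if i = sched k \<and> j \<in> Nin E (sched k)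
     then max (tau (int k - 1) (sched k) j) (int k - int (d k j)) else tau (int k - 1) i j)"
  "v (int (Suc k)) i = (if i = sched k then x k (sched k) - \<gamma> *\<^sub>R z k (sched k) else v (int k) i)"
  "x (Suc k) i = (if i = sched k then W i i *\<^sub>R v (int (Suc k)) i
     + (\<Sum>j\<in>Nin E i. W i j *\<^sub>R v (tau (int k) i j) j) else x k i)"
  "z (Suc k) i = (if i = sched k then A i i *\<^sub>R zhalf k else z k i)"
  "rho (int (Suc k)) i j = (if j = sched k \<and> i \<in> Nout E (sched k)
     then rho (int k) i j + A i j *\<^sub>R zhalf k else rho (int k) i j)"
  "rt (Suc k) i j = (if i = sched k \<and> j \<in> Nin E (sched k) then rho (tau (int k) i j) i j else rt k i j)"
proof -
  note r = run[unfolded asy_sonata_def Let_def, THEN conjunct2, THEN conjunct2, THEN conjunct2,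
      THEN conjunct2, THEN conjunct2, THEN spec[of _ k]]
  have k: "int (Suc k) = int k + 1" by simp
  show "tau (int k) i j = (if i = sched k \<and> j \<in> Nin E (sched k)
     then max (tau (int k - 1) (sched k) j) (int k - int (d k j)) else tau (int k - 1) i j)"
    using r[THEN conjunct1, THEN spec, THEN spec] .
  show "v (int (Suc k)) i = (if i = sched k then x k (sched k) - \<gamma> *\<^sub>R z k (sched k) else v (int k) i)"
    unfolding k using r[THEN conjunct2, THEN conjunct1, THEN spec] .
  show "x (Suc k) i = (if i = sched k then W i i *\<^sub>R v (int (Suc k)) i
     + (\<Sum>j\<in>Nin E i. W i j *\<^sub>R v (tau (int k) i j) j) else x k i)"
    unfolding k using r[THEN conjunct2, THEN conjunct2, THEN conjunct1, THEN spec, of i] by simp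
  show "z (Suc k) i = (if i = sched k then A i i *\<^sub>R zhalf k else z k i)"
    unfolding zhalf_def
    using r[THEN conjunct2, THEN conjunct2, THEN conjunct2, THEN conjunct1, THEN conjunct1, THEN spec, of i]
    by simp
  show "rho (int (Suc k)) i j = (if j = sched k \<and> i \<in> Nout E (sched k)
     then rho (int k) i j + A i j *\<^sub>R zhalf k else rho (int k) i j)"
    unfolding zhalf_def k
    using r[THEN conjunct2, THEN conjunct2, THEN conjunct2, THEN conjunct1, THEN conjunct2, THEN spec, THEN spec, of i j]
    by simp
  show "rt (Suc k) i j = (if i = sched k \<and> j \<in> Nin E (sched k) then rho (tau (int k) i j) i j else rt k i j)"
    using r[THEN conjunct2, THEN conjunct2, THEN conjunct2, THEN conjunct2, THEN spec, THEN spec, of i j] by simp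
qed

lemma tau_stamp: "- int D \<le> tau (int k - 1) i j \<and> nat (tau (int k - 1) i j) = \<theta> k i j"
proof (induction k)
  case 0
  then show ?case by (simp add: init)
next
  case (Suc k)
  have *: "int (Suc k) - 1 = int k" by simp
  show ?case unfolding * using Suc step(1)[of k i j] by (auto simp: nat_diff_distrib')
qed

lemma tau_bounds: "- int D \<le> tau (int k) i j" "nat (tau (int k) i j) = \<theta> (Suc k) i j"
  using tau_stamp[of "Suc k" i j] by (simp_all del: stamp.simps)

lemma v_tau: "v (tau (int k) i j) l = v (int (\<theta> (Suc k) i j)) l"
  using tau_bounds[of k i j] init(5)[of "tau (int k) i j" l] init(5)[of 0 l]
  by (cases "0 \<le> tau (int k) i j") (auto simp: tau_bounds(2)[symmetric] simp del: stamp.simps)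

lemma rho_tau: "rho (tau (int k) i j) l l' = rho (int (\<theta> (Suc k) i j)) l l'"
  using tau_bounds[of k i j] init(4)[of "tau (int k) i j" l l'] init(4)[of 0 l l']
  by (cases "0 \<le> tau (int k) i j") (auto simp: tau_bounds(2)[symmetric] simp del: stamp.simps)

text \<open>What has been consumed is the cumulative \<open>rho\<close> at the latest stamp. The
  correction in the tracking step is therefore the mass sent between two consecutive stamps.\<close>

lemma rt_stamp: "rt k i j = rho (int (\<theta> k i j)) i j"
proof (induction k)
  case 0
  then show ?case by (simp add: init)
next
  case (Suc k)
  then show ?case using step(6)[of k i j] rho_tau[of k i j i j] by (auto split: if_splits)
qed

section \<open>Iterates and buffers as a driven mixing system\<close>

text \<open>For \<open>r > k\<close> the truncated difference is time 0, where \<open>v\<close>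
  vanishes as it does at the negative times of the initialization.\<close>

definition mix_state :: "nat \<Rightarrow> 'v \<times> nat \<Rightarrow> 'a" where
  "mix_state k a = (case snd a of 0 \<Rightarrow> x k (fst a) | Suc r \<Rightarrow> v (int (k - r)) (fst a))"

definition mix_input :: "nat \<Rightarrow> 'v \<times> nat \<Rightarrow> 'a" where
  "mix_input k b = (if b = (sched k, 0) then - (\<gamma> *\<^sub>R z k (sched k)) else 0)"

lemma x_active:
  "x (Suc k) (sched k) = (\<Sum>j\<in>UNIV. W (sched k) j *\<^sub>R (mix_state k (j, lag k j) + mix_input k (j, lag k j)))"
proof -
  let ?i = "sched k"
  let ?g = "\<lambda>j. W ?i j *\<^sub>R (mix_state k (j, lag k j) + mix_input k (j, lag k j))"
  have "(\<Sum>j\<in>UNIV. ?g j) = ?g ?i + (\<Sum>j\<in>UNIV - {?i}. ?g j)"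
    by (simp add: sum.remove)
  also have "(\<Sum>j\<in>UNIV - {?i}. ?g j) = (\<Sum>j\<in>Nin E ?i. ?g j)"
    using noloops W_zero by (intro sum.mono_neutral_right) (auto simp: Nin_def)
  also have "\<dots> = (\<Sum>j\<in>Nin E ?i. W ?i j *\<^sub>R v (tau (int k) ?i j) j)"
  proof (intro sum.cong refl)
    fix j assume "j \<in> Nin E ?i"
    then have "j \<noteq> ?i" using noloops by (auto simp: Nin_def)
    \<comment> \<open>The stamp is at most \<open>k\<close>, so that the truncated
      \<open>k - (k - stamp)\<close> is the stamp itself.\<close>
    then show "?g j = W ?i j *\<^sub>R v (tau (int k) ?i j) j"
      using stamp_Suc_le[of k ?i j] unfolding v_tau
      by (simp add: mix_state_def mix_input_def lag_def del: stamp.simps)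
  qed
  also have "?g ?i = W ?i ?i *\<^sub>R v (int (Suc k)) ?i"
    unfolding step(2) by (simp add: mix_state_def mix_input_def lag_def)
  finally show ?thesis using step(3)[of k ?i] by simp
qed

lemma mix_state_Suc:
  assumes "a \<in> mix_nodes"
  shows "mix_state (Suc k) a = (\<Sum>b\<in>mix_nodes. mix k a b *\<^sub>R (mix_state k b + mix_input k b))"
proof (cases "a = (sched k, 0)")
  case True
  then show ?thesis unfolding mix_apply[OF assms] using x_active by (simp add: mix_state_def)
next
  case False
  obtain l r where a: "a = (l, r)" by (cases a)
  have "mix_state (Suc k) a = mix_state k (origin k a) + mix_input k (origin k a)"
  proof (cases "(k, a)" rule: origin.cases)
    case (1 k l)
    then show ?thesis using False step(3)[of k l] by (auto simp: mix_state_def mix_input_def)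
  next
    case (2 k l)
    then show ?thesis using step(2)[of k l] by (auto simp: mix_state_def mix_input_def)
  next
    case (3 k l r)
    then show ?thesis by (auto simp: mix_state_def mix_input_def)
  qed
  then show ?thesis unfolding mix_apply[OF assms] using False by simp
qed

section \<open>Trackers and packets as a driven push system\<close>

text \<open>Since \<open>rho\<close> is cumulative, one packet is one increment of it. The lower
  bound on \<open>s\<close> says that the packet is unread and also makes \<open>s\<close> positive,
  so that \<open>s - 1\<close> is not truncated.\<close>

definition push_state :: "nat \<Rightarrow> 'v + 'v \<times> 'v \<times> nat \<Rightarrow> 'a" where
  "push_state k a = (case a of Inl i \<Rightarrow> z k i
     | Inr (i, j, s) \<Rightarrow> if \<theta> k i j < s \<and> s \<le> k then rho (int s) i j - rho (int (s - 1)) i j else 0)"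

definition grad_change :: "nat \<Rightarrow> 'a" where
  "grad_change k = grad (sched k) (x (Suc k) (sched k)) - grad (sched k) (x k (sched k))"

definition push_input :: "nat \<Rightarrow> 'v + 'v \<times> 'v \<times> nat \<Rightarrow> 'a" where
  "push_input k b = (if b = Inl (sched k) then grad_change k else 0)"

text \<open>Labels up to the old stamp and beyond \<open>k\<close> are empty; the increments between
  the old and the new stamp telescope.\<close>

lemma taken_packets_sum:
  assumes j: "j \<in> Nin E (sched k)" and k: "k < N"
  shows "(\<Sum>s\<le>N. if s \<le> \<theta> (Suc k) (sched k) j \<or> k < s then push_state k (Inr (sched k, j, s)) else 0)
    = rho (tau (int k) (sched k) j) (sched k) j - rt k (sched k) j"
proof -
  let ?i = "sched k"
  let ?a = "\<theta> k ?i j" and ?b = "\<theta> (Suc k) ?i j"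
  let ?r = "\<lambda>s. rho (int s) ?i j"
  have ab: "?a \<le> ?b" "?b \<le> k" by (rule stamp_mono_Suc, rule stamp_Suc_le)
  have "(\<Sum>s\<le>N. if s \<le> ?b \<or> k < s then push_state k (Inr (?i, j, s)) else 0)
      = (\<Sum>s\<in>{Suc ?a..?b}. ?r s - ?r (s - 1))"
    using ab k by (intro sum.mono_neutral_cong_right) (auto simp: push_state_def simp del: stamp.simps)
  also have "\<dots> = ?r ?b - ?r ?a"
    using ab(1)
  proof (induction rule: dec_induct)
    case base
    then show ?case by simp
  next
    case (step n)
    then show ?case by (simp add: atLeastAtMostSuc_conv del: stamp.simps of_nat_Suc)
  qed
  finally show ?thesis by (simp only: rho_tau rt_stamp)
qed

lemma taken_sum:
  assumes k: "k < N"
  shows "(\<Sum>b\<in>{b\<in>push_nodes N. taken k b}. push_state k b + push_input k b) = zhalf k"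
proof -
  let ?i = "sched k"
  let ?F = "\<lambda>b. if taken k b then push_state k b + push_input k b else 0"
  have "(\<Sum>b\<in>{b\<in>push_nodes N. taken k b}. push_state k b + push_input k b) = (\<Sum>b\<in>push_nodes N. ?F b)"
    by (simp add: sum.inter_filter finite_push_nodes)
  also have "\<dots> = (\<Sum>i\<in>UNIV. ?F (Inl i)) + (\<Sum>(i, j, s)\<in>{(i, j, s). (j, i) \<in> E \<and> s \<le> N}. ?F (Inr (i, j, s)))"
    unfolding push_nodes_def
    by (subst sum.Plus[OF finite finite_packets]) (auto simp: o_def intro!: sum.cong)
  also have "(\<Sum>i\<in>UNIV. ?F (Inl i)) = (\<Sum>i\<in>UNIV. if i = ?i then z k i + grad_change k else 0)"
    by (intro sum.cong) (auto simp: taken_def push_state_def push_input_def)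
  also have "\<dots> = z k ?i + grad_change k" by simp
  also have "(\<Sum>(i, j, s)\<in>{(i, j, s). (j, i) \<in> E \<and> s \<le> N}. ?F (Inr (i, j, s)))
     = (\<Sum>i\<in>UNIV. \<Sum>j\<in>Nin E i. \<Sum>s\<le>N. ?F (Inr (i, j, s)))"
    by (rule sum_packets)
  also have "\<dots> = (\<Sum>i\<in>UNIV. if i = ?i then \<Sum>j\<in>Nin E i. \<Sum>s\<le>N. ?F (Inr (i, j, s)) else 0)"
    by (intro sum.cong) (auto simp: taken_def)
  also have "\<dots> = (\<Sum>j\<in>Nin E ?i. \<Sum>s\<le>N. ?F (Inr (?i, j, s)))" by simp
  also have "\<dots> = (\<Sum>j\<in>Nin E ?i. rho (tau (int k) ?i j) ?i j - rt k ?i j)"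
  proof (intro sum.cong refl)
    fix j assume j: "j \<in> Nin E ?i"
    show "(\<Sum>s\<le>N. ?F (Inr (?i, j, s))) = rho (tau (int k) ?i j) ?i j - rt k ?i j"
      unfolding taken_packets_sum[OF j k, symmetric]
      by (intro sum.cong) (auto simp: taken_def push_input_def simp del: stamp.simps)
  qed
  finally show ?thesis by (simp add: zhalf_def grad_change_def)
qed

lemma push_state_Suc:
  assumes a: "a \<in> push_nodes N" and k: "k < N"
  shows "push_state (Suc k) a = (\<Sum>b\<in>push_nodes N. push N k a b *\<^sub>R (push_state k b + push_input k b))"
  unfolding push_apply[OF a] taken_sum[OF k]
proof (cases a)
  case (Inl i)
  then show "push_state (Suc k) a = share N k a *\<^sub>R zhalf k + (if taken k a then 0 else push_state k a + push_input k a)"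
    using step(4)[of k i] by (auto simp: push_state_def share_def taken_def push_input_def)
next
  case (Inr p)
  obtain i j s where p: "p = (i, j, s)" by (cases p)
  have ji: "(j, i) \<in> E" and s: "s \<le> N" using a Inr p by auto
  then have ne: "i \<noteq> j" using noloops by auto
  \<comment> \<open>Below the horizon the cap on new labels is inactive.\<close>
  have mk: "min (Suc k) N = Suc k" using k by simp
  have in0: "push_input k a = 0" using Inr by (simp add: push_input_def)
  have rho: "rho (int (Suc k)) i j - rho (int k) i j = (if j = sched k then A i j *\<^sub>R zhalf k else 0)"
    using step(5)[of k i j] ji by (auto simp: Nout_def)
  have th: "\<theta> (Suc k) i j \<le> k" by (rule stamp_Suc_le)
  show "push_state (Suc k) a = share N k a *\<^sub>R zhalf k + (if taken k a then 0 else push_state k a + push_input k a)"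
  proof (cases "s = Suc k")
    \<comment> \<open>The node of a fresh label was empty at time \<open>k\<close>, so its new
      content is the share alone, whether or not the receiver takes it.\<close>
    case True
    then have "push_state (Suc k) a = (if j = sched k then A i j *\<^sub>R zhalf k else 0)"
      using rho th Inr p by (simp add: push_state_def del: stamp.simps of_nat_Suc)
    moreover have "push_state k a = 0" using True Inr p by (simp add: push_state_def)
    ultimately show ?thesis using True Inr p mk in0 by (auto simp: share_def)
  next
    case False
    then have "share N k a = 0" using Inr p mk by (simp add: share_def)
    moreover have "push_state (Suc k) a = (if taken k a then 0 else push_state k a)"
    proof (cases "i = sched k")
      case True
      have "\<theta> k i j \<le> \<theta> (Suc k) i j" by (rule stamp_mono_Suc)
      then show ?thesis using True False Inr p th
        by (auto simp: push_state_def taken_def simp del: stamp.simps)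
    next
      case i: False
      then have "\<theta> (Suc k) i j = \<theta> k i j" by simp
      then show ?thesis using i False Inr p 
        by (auto simp: push_state_def taken_def simp del: stamp.simps)
    qed
    ultimately show ?thesis using in0 by simp
  qed
qed

definition grad_sum :: "nat \<Rightarrow> 'a" where
  "grad_sum k = (\<Sum>i\<in>UNIV. grad i (x k i))"

lemma grad_sum_Suc: "grad_sum (Suc k) = grad_sum k + grad_change k"
proof -
  have "grad_sum (Suc k) - grad_sum k = (\<Sum>i\<in>UNIV. if i = sched k then grad_change k else 0)"
    unfolding grad_sum_def sum_subtractf[symmetric]
    using step(3)[of k] by (intro sum.cong) (auto simp: grad_change_def)
  then show ?thesis by (simp add: algebra_simps)
qed

lemma push_input_sum: "(\<Sum>b\<in>push_nodes N. push_input k b) = grad_change k"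
  unfolding push_input_def by (simp add: finite_push_nodes)

text \<open>The invariant of gradient tracking: unit column sums preserve mass, so the total changes
  only by the gradient increment. Initially all packets are empty and the trackers hold the local
  gradients.\<close>

lemma total_mass:
  assumes "k \<le> N"
  shows "(\<Sum>a\<in>push_nodes N. push_state k a) = grad_sum k"
  using assms
proof (induction k)
  case 0
  have "(\<Sum>a\<in>push_nodes N. push_state 0 a)
      = (\<Sum>i\<in>UNIV. push_state 0 (Inl i)) + (\<Sum>p\<in>{(i, j, s). (j, i) \<in> E \<and> s \<le> N}. push_state 0 (Inr p))"
    unfolding push_nodes_def by (subst sum.Plus[OF finite finite_packets]) (simp add: o_def)
  also have "(\<Sum>p\<in>{(i, j, s). (j, i) \<in> E \<and> s \<le> N}. push_state 0 (Inr p)) = 0"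
    by (intro sum.neutral) (auto simp: push_state_def)
  finally show ?case by (simp add: push_state_def init grad_sum_def)
next
  case (Suc k)
  have "(\<Sum>a\<in>push_nodes N. push_state (Suc k) a)
      = (\<Sum>a\<in>push_nodes N. \<Sum>b\<in>push_nodes N. push N k a b *\<^sub>R (push_state k b + push_input k b))"
    using Suc.prems push_state_Suc by (intro sum.cong) auto
  also have "\<dots> = (\<Sum>b\<in>push_nodes N. (\<Sum>a\<in>push_nodes N. push N k a b) *\<^sub>R (push_state k b + push_input k b))"
    unfolding scaleR_sum_left by (rule sum.swap)
  also have "\<dots> = grad_sum k + grad_change k"
    using Suc by (simp add: push_col_sum sum.distrib push_input_sum)
  finally show ?case by (simp add: grad_sum_Suc)
qed

end

subsection \<open>Smoothness and summation inequalities\<close>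

text \<open>The descent lemma with \<open>L\<close> in place of \<open>L / 2\<close>: the mean value
  theorem at a single point of the segment gives this weaker constant without integration.\<close>

lemma smooth_upper_bound:
  fixes F :: "'a::euclidean_space \<Rightarrow> real"
  assumes der: "\<And>y. (F has_derivative (\<lambda>h. G y \<bullet> h)) (at y)"
    and lip: "\<And>y y'. norm (G y - G y') \<le> L * norm (y - y')" and L: "0 \<le> L"
  shows "F (y + h) \<le> F y + G y \<bullet> h + L * (norm h)\<^sup>2"
proof -
  have "((\<lambda>t. F (y + t *\<^sub>R h)) has_derivative (\<lambda>dt. G (y + t *\<^sub>R h) \<bullet> (dt *\<^sub>R h))) (at t)" for t :: real
    by (rule has_derivative_compose[OF _ der, where f = "\<lambda>t. y + t *\<^sub>R h"]) (auto intro!: derivative_eq_intros)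
  then obtain t where t: "t \<in> {0..1::real}" "F (y + 1 *\<^sub>R h) - F (y + 0 *\<^sub>R h) = G (y + t *\<^sub>R h) \<bullet> ((1 - 0) *\<^sub>R h)"
    using mvt_very_simple[of 0 1 "\<lambda>t. F (y + t *\<^sub>R h)" "\<lambda>t dt. G (y + t *\<^sub>R h) \<bullet> (dt *\<^sub>R h)"]
    by (metis has_derivative_at_withinI zero_le_one)
  have "G (y + t *\<^sub>R h) \<bullet> h = G y \<bullet> h + (G (y + t *\<^sub>R h) - G y) \<bullet> h"
    by (simp add: inner_diff_left)
  also have "(G (y + t *\<^sub>R h) - G y) \<bullet> h \<le> norm (G (y + t *\<^sub>R h) - G y) * norm h"
    by (rule norm_cauchy_schwarz)
  also have "\<dots> \<le> (L * norm h) * norm h"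
  proof (rule mult_right_mono)
    have "norm (G (y + t *\<^sub>R h) - G y) \<le> L * (\<bar>t\<bar> * norm h)" using lip[of "y + t *\<^sub>R h" y] by simp
    also have "\<dots> \<le> L * (1 * norm h)"
      using t L by (intro mult_left_mono mult_right_mono) auto
    finally show "norm (G (y + t *\<^sub>R h) - G y) \<le> L * norm h" by simp
  qed simp
  finally show ?thesis using t(2) by (simp add: power2_eq_square mult.assoc)
qed

text \<open>Convexity of the square at the points \<open>a\<close> and \<open>b / \<eta>\<close>
  with weights \<open>1 - \<eta>\<close> and \<open>\<eta>\<close>; the contraction factor survives
  squaring.\<close>

lemma square_convex_combination_le:
  fixes a b \<eta> :: real
  assumes "0 < \<eta>" "\<eta> \<le> 1"
  shows "((1 - \<eta>) * a + b)\<^sup>2 \<le> (1 - \<eta>) * a\<^sup>2 + b\<^sup>2 / \<eta>"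
proof -
  have "(1 - \<eta>) * a\<^sup>2 + b\<^sup>2 / \<eta> - ((1 - \<eta>) * a + b)\<^sup>2 = \<eta> * (1 - \<eta>) * (a - b / \<eta>)\<^sup>2"
    using assms by (simp add: power2_eq_square field_simps)
  moreover have "0 \<le> \<eta> * (1 - \<eta>) * (a - b / \<eta>)\<^sup>2" using assms by simp
  ultimately show ?thesis by linarith
qed

text \<open>Square the contraction, sum over \<open>k\<close> and absorb the factor
  \<open>1 - \<eta>\<close> on the left; the first \<open>K\<close> terms have no predecessor and
  stay. One factor \<open>K\<close> comes from Cauchy-Schwarz in a window, the other because each
  \<open>u k\<close> lies in at most \<open>K\<close> windows.\<close>

lemma window_contraction_sum_squares:
  fixes s u :: "nat \<Rightarrow> real"
  assumes \<eta>: "0 < \<eta>" "\<eta> \<le> 1"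
    and s: "\<And>k. 0 \<le> s k" and u: "\<And>k. 0 \<le> u k"
    and con: "\<And>k. k + K < n \<Longrightarrow> s (k + K) \<le> (1 - \<eta>) * s k + (\<Sum>t<K. u (k + t))"
  shows "\<eta> * (\<Sum>k<n. (s k)\<^sup>2) \<le> (\<Sum>k<K. (s k)\<^sup>2) + (real K)\<^sup>2 / \<eta> * (\<Sum>k<n. (u k)\<^sup>2)"
proof (cases "n \<le> K")
  case True
  have "\<eta> * (\<Sum>k<n. (s k)\<^sup>2) \<le> 1 * (\<Sum>k<n. (s k)\<^sup>2)"
    using \<eta> by (intro mult_right_mono sum_nonneg) auto
  also have "\<dots> \<le> (\<Sum>k<K. (s k)\<^sup>2)" using True by (auto intro!: sum_mono2)
  finally have "\<eta> * (\<Sum>k<n. (s k)\<^sup>2) \<le> (\<Sum>k<K. (s k)\<^sup>2)" .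
  moreover have "0 \<le> (real K)\<^sup>2 / \<eta> * (\<Sum>k<n. (u k)\<^sup>2)"
    using \<eta> by (intro mult_nonneg_nonneg sum_nonneg) auto
  ultimately show ?thesis by linarith
next
  case False
  define n' where "n' = n - K"
  have n: "n = n' + K" using False by (simp add: n'_def)
  have sq: "(s (k + K))\<^sup>2 \<le> (1 - \<eta>) * (s k)\<^sup>2 + real K / \<eta> * (\<Sum>t<K. (u (k + t))\<^sup>2)" if "k < n'" for k
  proof -
    have "(s (k + K))\<^sup>2 \<le> ((1 - \<eta>) * s k + (\<Sum>t<K. u (k + t)))\<^sup>2"
      using con[of k] that s n by (intro power_mono) auto
    also have "\<dots> \<le> (1 - \<eta>) * (s k)\<^sup>2 + (\<Sum>t<K. u (k + t))\<^sup>2 / \<eta>"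
      by (rule square_convex_combination_le[OF \<eta>])
    also have "(\<Sum>t<K. u (k + t))\<^sup>2 \<le> real K * (\<Sum>t<K. (u (k + t))\<^sup>2)"
      using sum_squared_le_sum_of_squares[of "\<lambda>t. u (k + t)" "{..<K}"] by (simp add: mult.commute)
    finally show ?thesis using \<eta> by (simp add: divide_right_mono)
  qed
  have shift: "(\<Sum>k<n'. (u (k + t))\<^sup>2) \<le> (\<Sum>k<n. (u k)\<^sup>2)" if "t < K" for t
  proof -
    have "(\<Sum>k<n'. (u (k + t))\<^sup>2) = (\<Sum>k\<in>(\<lambda>k. k + t) ` {..<n'}. (u k)\<^sup>2)"
      by (simp add: sum.reindex)
    also have "\<dots> \<le> (\<Sum>k<n. (u k)\<^sup>2)" using that n by (intro sum_mono2) auto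
    finally show ?thesis .
  qed
  have "(\<Sum>k<n. (s k)\<^sup>2) = (\<Sum>k<K. (s k)\<^sup>2) + (\<Sum>k<n'. (s (k + K))\<^sup>2)"
    unfolding n by (induction n') (simp_all add: ac_simps)
  also have "(\<Sum>k<n'. (s (k + K))\<^sup>2)
      \<le> (\<Sum>k<n'. (1 - \<eta>) * (s k)\<^sup>2 + real K / \<eta> * (\<Sum>t<K. (u (k + t))\<^sup>2))"
    using sq by (intro sum_mono) auto
  also have "\<dots> = (1 - \<eta>) * (\<Sum>k<n'. (s k)\<^sup>2) + real K / \<eta> * (\<Sum>t<K. \<Sum>k<n'. (u (k + t))\<^sup>2)"
    unfolding sum.distrib sum_distrib_left[symmetric] by (subst sum.swap) simp
  also have "\<dots> \<le> (1 - \<eta>) * (\<Sum>k<n. (s k)\<^sup>2) + real K / \<eta> * (\<Sum>t<K. \<Sum>k<n. (u k)\<^sup>2)"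
    using \<eta> n shift by (intro add_mono mult_left_mono sum_mono sum_mono2) auto
  finally show ?thesis using \<eta> by (simp add: algebra_simps power2_eq_square)
qed

text \<open>\<open>X\<close>, \<open>Y\<close>, \<open>Z\<close> stand for the sums of squared
  gradients, of squared disagreement plus tracking error, and of squared directions
  \<open>z\<close>. By \<open>g1\<close> the bound for \<open>Y\<close> absorbs half of
  \<open>Y\<close>. By \<open>g2\<close> and \<open>g3\<close> the two error terms in
  \<open>X\<close> cost a quarter of \<open>\<gamma> * a * X\<close> each, which leaves half of
  it.\<close>

lemma small_step_closure:
  fixes X Y Z \<gamma> :: real
  assumes nn: "0 \<le> X" "0 \<le> Y" "0 < \<gamma>" "0 < a" "0 \<le> c1" "0 \<le> c3" "0 \<le> c4" "0 \<le> \<Lambda>"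
    and Y: "Y \<le> C1 + c4 * \<gamma>\<^sup>2 * Z" and Z: "Z \<le> 3 * X + c3 * Y"
    and X: "\<gamma> * a * X \<le> C2 + \<gamma> * c1 * Y + \<Lambda> * \<gamma>\<^sup>2 * Z"
    and g1: "\<gamma>\<^sup>2 * (c3 * c4) \<le> 1 / 2" and g2: "24 * (c1 * c4) * \<gamma>\<^sup>2 \<le> a" and g3: "24 * \<Lambda> * \<gamma> \<le> a"
  shows "X \<le> 2 * (C2 + 2 * \<gamma> * c1 * C1 + 2 * \<Lambda> * \<gamma>\<^sup>2 * c3 * C1) / (\<gamma> * a)" (is "X \<le> ?B")
    and "Y \<le> 2 * C1 + 6 * c4 * \<gamma>\<^sup>2 * X"
proof -
  have "Y \<le> C1 + c4 * \<gamma>\<^sup>2 * (3 * X + c3 * Y)"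
    using Y Z nn by (smt (verit) mult_left_mono mult_nonneg_nonneg zero_le_power2)
  also have "\<dots> = C1 + 3 * c4 * \<gamma>\<^sup>2 * X + (\<gamma>\<^sup>2 * (c3 * c4)) * Y" by (simp add: algebra_simps)
  also have "\<dots> \<le> C1 + 3 * c4 * \<gamma>\<^sup>2 * X + 1 / 2 * Y"
    using g1 nn by (intro add_left_mono mult_right_mono) auto
  finally show Y': "Y \<le> 2 * C1 + 6 * c4 * \<gamma>\<^sup>2 * X" by simp
  have Z': "Z \<le> 6 * X + 2 * c3 * C1"
  proof -
    have "c3 * Y \<le> c3 * (2 * C1 + 6 * c4 * \<gamma>\<^sup>2 * X)" using Y' nn by (intro mult_left_mono) auto
    also have "\<dots> = 2 * c3 * C1 + 6 * ((\<gamma>\<^sup>2 * (c3 * c4)) * X)" by (simp add: algebra_simps)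
    also have "(\<gamma>\<^sup>2 * (c3 * c4)) * X \<le> 1 / 2 * X" using g1 nn by (intro mult_right_mono) auto
    finally show ?thesis using Z by simp
  qed
  have 1: "\<gamma> * c1 * Y \<le> 2 * \<gamma> * c1 * C1 + \<gamma> * a * X / 4"
  proof -
    have "\<gamma> * c1 * Y \<le> \<gamma> * c1 * (2 * C1 + 6 * c4 * \<gamma>\<^sup>2 * X)" using Y' nn by (intro mult_left_mono) auto
    also have "\<dots> = 2 * \<gamma> * c1 * C1 + (24 * (c1 * c4) * \<gamma>\<^sup>2) * (\<gamma> * X / 4)" by (simp add: algebra_simps)
    also have "(24 * (c1 * c4) * \<gamma>\<^sup>2) * (\<gamma> * X / 4) \<le> a * (\<gamma> * X / 4)"
      using g2 nn by (intro mult_right_mono) auto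
    finally show ?thesis by (simp add: algebra_simps)
  qed
  have 2: "\<Lambda> * \<gamma>\<^sup>2 * Z \<le> 2 * \<Lambda> * \<gamma>\<^sup>2 * c3 * C1 + \<gamma> * a * X / 4"
  proof -
    have "\<Lambda> * \<gamma>\<^sup>2 * Z \<le> \<Lambda> * \<gamma>\<^sup>2 * (6 * X + 2 * c3 * C1)" using Z' nn by (intro mult_left_mono) auto
    also have "\<dots> = 2 * \<Lambda> * \<gamma>\<^sup>2 * c3 * C1 + (24 * \<Lambda> * \<gamma>) * (\<gamma> * X / 4)"
      by (simp add: algebra_simps power2_eq_square)
    also have "(24 * \<Lambda> * \<gamma>) * (\<gamma> * X / 4) \<le> a * (\<gamma> * X / 4)"
      using g3 nn by (intro mult_right_mono) auto
    finally show ?thesis by (simp add: algebra_simps)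
  qed
  have "X * (\<gamma> * a) \<le> 2 * (C2 + 2 * \<gamma> * c1 * C1 + 2 * \<Lambda> * \<gamma>\<^sup>2 * c3 * C1)"
    using X 1 2 by (simp add: algebra_simps)
  then show "X \<le> ?B" using nn by (simp add: pos_le_divide_eq)
qed

lemma norm_diff_xbar_le:
  fixes xs :: "'v::finite \<Rightarrow> 'a::euclidean_space"
  assumes "\<And>i. norm (y - xs i) \<le> r"
  shows "norm (y - xbar xs) \<le> r"
proof -
  have "y - xbar xs = (1 / real CARD('v)) *\<^sub>R (\<Sum>i\<in>UNIV. y - xs i)"
    by (simp add: xbar_def sum_subtractf scaleR_diff_right sum_constant_scaleR)
  also have "norm \<dots> \<le> (1 / real CARD('v)) * (\<Sum>i\<in>(UNIV::'v set). r)"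
    unfolding norm_scaleR by (intro mult_mono sum_norm_le assms) auto
  finally show ?thesis by simp
qed

subsection \<open>Descent and summability of the merit function\<close>

text \<open>\<open>K\<close> and \<open>\<eta>\<close> are parameters because they come from the
  network alone; the step-size threshold can thus be fixed before the trajectory.\<close>

locale smooth_run = sonata_run E W A m T D sched d grad \<gamma> x z v rho rt tau
  for E :: "('v::finite \<times> 'v) set" and W A m T D sched d
    and grad :: "'v \<Rightarrow> 'a::euclidean_space \<Rightarrow> 'a" and \<gamma> x z v rho rt tau +
  fixes f :: "'v \<Rightarrow> 'a \<Rightarrow> real" and L :: "'v \<Rightarrow> real" and K :: nat and \<eta> :: real
  assumes derivative: "(f i has_derivative (\<lambda>h. grad i y \<bullet> h)) (at y)"
    and lipschitz: "lipschitz_on (L i) UNIV (grad i)"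
    and \<gamma>_pos: "0 < \<gamma>" and K_pos: "0 < K" and \<eta>_pos: "0 < \<eta>" and \<eta>_le_1: "\<eta> \<le> 1"
    and mix_ge: "a \<in> mix_nodes \<Longrightarrow> \<eta> \<le> mprod mix_nodes mix s K a (l, 0)"
    and push_ge: "b \<in> push_nodes N \<Longrightarrow> \<eta> \<le> mprod (push_nodes N) (push N) s K (Inl l) b"
begin

definition F :: "'a \<Rightarrow> real" where "F y = (\<Sum>i\<in>UNIV. f i y)"
definition GF :: "'a \<Rightarrow> 'a" where "GF y = (\<Sum>i\<in>UNIV. grad i y)"
definition \<Lambda> :: real where "\<Lambda> = (\<Sum>i\<in>UNIV. L i)"

definition S :: "nat \<Rightarrow> real" where "S k = spread mix_nodes (mix_state k)"
definition \<zeta> :: "nat \<Rightarrow> real" where "\<zeta> k = norm (z k (sched k))"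

text \<open>The start node is an arbitrary choice, for which \<open>sched 0\<close> supplies an
  agent.\<close>

definition \<xi> :: "nat \<Rightarrow> nat \<Rightarrow> 'v + 'v \<times> 'v \<times> nat \<Rightarrow> real" where
  "\<xi> N k a = mprod (push_nodes N) (push N) 0 k a (Inl (sched 0))"
definition err :: "nat \<Rightarrow> nat \<Rightarrow> 'v + 'v \<times> 'v \<times> nat \<Rightarrow> 'a" where
  "err N k a = push_state k a - \<xi> N k a *\<^sub>R grad_sum k"
definition Er :: "nat \<Rightarrow> nat \<Rightarrow> real" where
  "Er N k = (\<Sum>a\<in>push_nodes N. norm (err N k a))"

text \<open>The adjoint counterpart of \<open>\<xi>\<close>: a row of the product from
  \<open>k\<close> to the horizon, so it evolves backwards in time.\<close>

definition \<psi> :: "nat \<Rightarrow> nat \<Rightarrow> 'v \<times> nat \<Rightarrow> real" where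
  "\<psi> N k b = mprod mix_nodes mix k (N - k) (sched 0, 0) b"
definition x\<psi> :: "nat \<Rightarrow> nat \<Rightarrow> 'a" where
  "x\<psi> N k = (\<Sum>b\<in>mix_nodes. \<psi> N k b *\<^sub>R mix_state k b)"

section \<open>Smoothness of the sum\<close>

lemma L_nonneg: "0 \<le> L i"
  using lipschitz by (rule lipschitz_on_nonneg)

lemma L_le: "L i \<le> \<Lambda>"
  unfolding \<Lambda>_def by (rule member_le_sum) (auto simp: L_nonneg)

lemma \<Lambda>_nonneg: "0 \<le> \<Lambda>"
  unfolding \<Lambda>_def by (intro sum_nonneg) (simp add: L_nonneg)

lemma grad_lipschitz: "norm (grad i y - grad i y') \<le> L i * norm (y - y')"
  using lipschitz_onD[OF lipschitz, of y y' i] by (simp add: dist_norm)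

lemma sum_grad_lipschitz:
  assumes "\<And>i. norm (ys i - y) \<le> r"
  shows "norm ((\<Sum>i\<in>UNIV. grad i (ys i)) - GF y) \<le> \<Lambda> * r"
proof -
  have "norm ((\<Sum>i\<in>UNIV. grad i (ys i)) - GF y) \<le> (\<Sum>i\<in>UNIV. L i * r)"
    unfolding GF_def sum_subtractf[symmetric]
    by (intro sum_norm_le) (meson grad_lipschitz assms L_nonneg mult_left_mono order_trans)
  then show ?thesis by (simp add: \<Lambda>_def sum_distrib_right)
qed

lemma GF_lipschitz: "norm (GF y - GF y') \<le> \<Lambda> * norm (y - y')"
  using sum_grad_lipschitz[of "\<lambda>_. y" y' "norm (y - y')"] by (simp add: GF_def)

lemma F_upper_bound: "F (y + h) \<le> F y + GF y \<bullet> h + \<Lambda> * (norm h)\<^sup>2"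
proof (rule smooth_upper_bound[OF _ GF_lipschitz \<Lambda>_nonneg])
  show "(F has_derivative (\<lambda>h. GF y \<bullet> h)) (at y)" for y
    unfolding F_def GF_def inner_sum_left by (intro has_derivative_sum derivative)
qed

section \<open>Recursion for the disagreement\<close>

lemma finite_mix_nodes: "finite mix_nodes" by simp

lemma mix_nodes_0: "(l, 0) \<in> mix_nodes" by simp

lemma S_nonneg: "0 \<le> S k"
  unfolding S_def using mix_nodes_0 by (intro spread_nonneg finite_mix_nodes) blast

lemma \<zeta>_nonneg: "0 \<le> \<zeta> k" by (simp add: \<zeta>_def)

lemma Er_nonneg: "0 \<le> Er N k" unfolding Er_def by (intro sum_nonneg) simp

lemma mix_input_le: "norm (mix_input k b) \<le> \<gamma> * \<zeta> k"
  using \<gamma>_pos by (simp add: mix_input_def \<zeta>_def)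

lemma S_contraction: "S (k + K) \<le> (1 - \<eta>) * S k + (\<Sum>t<K. 2 * (\<gamma> * \<zeta> (k + t)))"
proof -
  have "S (k + K) \<le> (1 - \<eta>) * S k + 2 * (\<Sum>t<K. \<gamma> * \<zeta> (k + t))"
    unfolding S_def
    by (rule spread_contraction[OF finite_mix_nodes mix_nodes_0 mix_nonneg mix_row_sum mix_state_Suc mix_input_le mix_ge])
  then show ?thesis by (simp only: sum_distrib_left)
qed

text \<open>The new iterate is a convex combination of the augmented states plus one of the inputs;
  the first part stays within the diameter \<open>S k\<close> of the old iterate.\<close>

lemma x_change_le: "norm (x (Suc k) (sched k) - x k (sched k)) \<le> S k + \<gamma> * \<zeta> k"
proof -
  let ?a = "(sched k, 0::nat)"
  have "x (Suc k) (sched k) = mix_state (Suc k) ?a" by (simp add: mix_state_def)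
  also have "\<dots> = (\<Sum>b\<in>mix_nodes. mix k ?a b *\<^sub>R mix_state k b) + (\<Sum>b\<in>mix_nodes. mix k ?a b *\<^sub>R mix_input k b)"
    unfolding mix_state_Suc[OF mix_nodes_0] by (simp add: scaleR_add_right sum.distrib)
  finally have "norm (x (Suc k) (sched k) - x k (sched k))
      \<le> norm (mix_state k ?a - (\<Sum>b\<in>mix_nodes. mix k ?a b *\<^sub>R mix_state k b))
        + norm (\<Sum>b\<in>mix_nodes. mix k ?a b *\<^sub>R mix_input k b)"
    using norm_triangle_ineq[of "(\<Sum>b\<in>mix_nodes. mix k ?a b *\<^sub>R mix_state k b) - x k (sched k)"
        "\<Sum>b\<in>mix_nodes. mix k ?a b *\<^sub>R mix_input k b"]
    by (simp add: mix_state_def norm_minus_commute algebra_simps)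
  also have "norm (mix_state k ?a - (\<Sum>b\<in>mix_nodes. mix k ?a b *\<^sub>R mix_state k b)) \<le> S k"
    unfolding S_def
    by (intro norm_diff_weighted_sum_le_spread finite_mix_nodes mix_nonneg mix_row_sum mix_nodes_0)
  also have "norm (\<Sum>b\<in>mix_nodes. mix k ?a b *\<^sub>R mix_input k b) \<le> (\<Sum>b\<in>mix_nodes. mix k ?a b * (\<gamma> * \<zeta> k))"
    by (intro sum_norm_le) (simp add: mix_nonneg mix_input_le mult_left_mono)
  also have "\<dots> = \<gamma> * \<zeta> k"
    unfolding sum_distrib_right[symmetric] mix_row_sum[OF mix_nodes_0] by simp
  finally show ?thesis by simp
qed

lemma grad_change_le: "norm (grad_change k) \<le> \<Lambda> * (S k + \<gamma> * \<zeta> k)"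
proof -
  have "norm (grad_change k) \<le> L (sched k) * norm (x (Suc k) (sched k) - x k (sched k))"
    unfolding grad_change_def by (rule grad_lipschitz)
  also have "\<dots> \<le> \<Lambda> * (S k + \<gamma> * \<zeta> k)"
    by (intro mult_mono L_le x_change_le \<Lambda>_nonneg norm_ge_zero)
  finally show ?thesis .
qed

section \<open>Recursion for the tracking error\<close>

lemma \<xi>_nonneg: "0 \<le> \<xi> N k a"
  unfolding \<xi>_def by (rule mprod_nonneg[of "push N", OF push_nonneg])

lemma \<xi>_sum: "(\<Sum>a\<in>push_nodes N. \<xi> N k a) = 1"
  unfolding \<xi>_def by (rule mprod_col_sum[of _ "push N"]) (simp_all add: finite_push_nodes push_col_sum)

lemma \<xi>_le_1: "a \<in> push_nodes N \<Longrightarrow> \<xi> N k a \<le> 1"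
  using member_le_sum[of a "push_nodes N" "\<xi> N k"] \<xi>_sum[of N k] \<xi>_nonneg finite_push_nodes by simp

text \<open>Split the product at time \<open>k - K\<close>: the last \<open>K\<close> factors have
  row \<open>Inl l\<close> at least \<open>\<eta>\<close>, and they act on a vector of mass
  one.\<close>

lemma \<xi>_ge: "K \<le> k \<Longrightarrow> \<eta> \<le> \<xi> N k (Inl l)"
proof -
  assume k: "K \<le> k"
  have "\<eta> = (\<Sum>c\<in>push_nodes N. \<eta> * \<xi> N (k - K) c)"
    by (simp add: sum_distrib_left[symmetric] \<xi>_sum)
  also have "\<dots> \<le> (\<Sum>c\<in>push_nodes N. mprod (push_nodes N) (push N) (k - K) K (Inl l) c * \<xi> N (k - K) c)"
    by (intro sum_mono mult_right_mono push_ge \<xi>_nonneg)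
  also have "\<dots> = \<xi> N k (Inl l)"
    unfolding \<xi>_def using mprod_add[OF finite_push_nodes, of "Inl l" N "push N" 0 "k - K" K] k by simp
  finally show ?thesis .
qed

text \<open>State and \<open>\<xi>\<close> evolve by the same matrices, so the error is driven by
  the new mass minus its share along \<open>\<xi>\<close>. The entries of this input sum to
  zero.\<close>

definition err_input :: "nat \<Rightarrow> nat \<Rightarrow> 'v + 'v \<times> 'v \<times> nat \<Rightarrow> 'a" where
  "err_input N k b = push_input k b - \<xi> N k b *\<^sub>R grad_change k"

lemma err_Suc:
  assumes "k < N" "a \<in> push_nodes N"
  shows "err N (Suc k) a = (\<Sum>b\<in>push_nodes N. push N k a b *\<^sub>R (err N k b + err_input N k b))"
proof -
  have "\<xi> N (Suc k) a *\<^sub>R (grad_sum k + grad_change k)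
      = (\<Sum>b\<in>push_nodes N. push N k a b *\<^sub>R (\<xi> N k b *\<^sub>R (grad_sum k + grad_change k)))"
    by (simp add: \<xi>_def scaleR_sum_left)
  then show ?thesis
    unfolding err_def err_input_def push_state_Suc[OF assms(2,1)] grad_sum_Suc
    by (simp add: sum_subtractf[symmetric] scaleR_diff_right[symmetric] algebra_simps)
qed

lemma err_input_le: "(\<Sum>b\<in>push_nodes N. norm (err_input N k b)) \<le> 2 * norm (grad_change k)"
proof -
  have "(\<Sum>b\<in>push_nodes N. norm (err_input N k b))
      \<le> (\<Sum>b\<in>push_nodes N. norm (push_input k b) + \<xi> N k b * norm (grad_change k))"
    unfolding err_input_def
    by (intro sum_mono order_trans[OF norm_triangle_ineq4]) (simp add: \<xi>_nonneg)
  also have "(\<Sum>b\<in>push_nodes N. norm (push_input k b) + \<xi> N k b * norm (grad_change k))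
     = (\<Sum>b\<in>push_nodes N. if b = Inl (sched k) then norm (grad_change k) else 0) + norm (grad_change k)"
    unfolding sum.distrib sum_distrib_right[symmetric] \<xi>_sum
    by (auto simp: push_input_def intro!: sum.cong)
  finally show ?thesis by (simp add: finite_push_nodes)
qed

lemma err_sum_0: "k \<le> N \<Longrightarrow> (\<Sum>a\<in>push_nodes N. err N k a) = 0"
  unfolding err_def sum_subtractf by (simp add: total_mass scaleR_sum_left[symmetric] \<xi>_sum)

lemma Er_contraction:
  assumes "k + K \<le> N"
  shows "Er N (k + K) \<le> (1 - \<eta>) * Er N k + (\<Sum>t<K. 2 * (\<Lambda> * (S (k + t) + \<gamma> * \<zeta> (k + t))))"
  unfolding Er_def
proof (rule l1_norm_contraction[OF finite_push_nodes Inl_in_push_nodes, where M = "push N" and u = "err_input N"])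
  fix r assume "r < k + K"
  show "(\<Sum>b\<in>push_nodes N. norm (err_input N r b)) \<le> 2 * (\<Lambda> * (S r + \<gamma> * \<zeta> r))"
    using err_input_le[of N r] grad_change_le[of r] by simp
qed (use assms push_nonneg push_col_sum err_Suc err_sum_0 push_ge in auto)

text \<open>A bound on the early tracking errors that does not involve the horizon; the constants of
  the final estimate must not depend on \<open>N\<close>.\<close>

definition Er_bound :: "nat \<Rightarrow> real" where
  "Er_bound k = (\<Sum>i\<in>UNIV. norm (z 0 i)) + norm (grad_sum 0) + (\<Sum>t<k. 2 * norm (grad_change t))"

lemma Er_le_bound:
  assumes "k \<le> N"
  shows "Er N k \<le> Er_bound k"
  using assms
proof (induction k)
  case 0
  have "Er N 0 \<le> (\<Sum>a\<in>push_nodes N. norm (push_state 0 a) + \<xi> N 0 a * norm (grad_sum 0))"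
    unfolding Er_def err_def
    by (intro sum_mono order_trans[OF norm_triangle_ineq4]) (simp add: \<xi>_nonneg)
  also have "\<dots> = (\<Sum>a\<in>push_nodes N. norm (push_state 0 a)) + norm (grad_sum 0)"
    unfolding sum.distrib sum_distrib_right[symmetric] \<xi>_sum by simp
  also have "(\<Sum>a\<in>push_nodes N. norm (push_state 0 a)) = (\<Sum>i\<in>UNIV. norm (z 0 i))
      + (\<Sum>p\<in>{(i, j, s). (j, i) \<in> E \<and> s \<le> N}. norm (push_state 0 (Inr p)))"
    unfolding push_nodes_def by (subst sum.Plus[OF finite finite_packets]) (simp add: o_def push_state_def)
  also have "(\<Sum>p\<in>{(i, j, s). (j, i) \<in> E \<and> s \<le> N}. norm (push_state 0 (Inr p))) = 0"
    by (intro sum.neutral) (auto simp: push_state_def)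
  finally show ?case by (simp add: Er_bound_def)
next
  case (Suc k)
  have "Er N (Suc k) = (\<Sum>a\<in>push_nodes N. norm (\<Sum>b\<in>push_nodes N. push N k a b *\<^sub>R (err N k b + err_input N k b)))"
    unfolding Er_def using Suc.prems by (intro sum.cong) (auto simp: err_Suc)
  also have "\<dots> \<le> 1 * (\<Sum>b\<in>push_nodes N. norm (err N k b + err_input N k b))"
    by (intro l1_norm_matrix_apply_le) (auto simp: push_nonneg push_col_sum)
  also have "\<dots> \<le> Er N k + (\<Sum>b\<in>push_nodes N. norm (err_input N k b))"
    unfolding Er_def sum.distrib[symmetric] by (simp add: sum_mono norm_triangle_ineq)
  finally show ?case using Suc err_input_le[of N k] by (simp add: Er_bound_def)
qed

lemma z_decomposition:
  obtains e where "z k i = \<xi> N k (Inl i) *\<^sub>R grad_sum k + e" "norm e \<le> Er N k"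
proof
  show "z k i = \<xi> N k (Inl i) *\<^sub>R grad_sum k + err N k (Inl i)"
    by (simp add: err_def push_state_def)
  show "norm (err N k (Inl i)) \<le> Er N k"
    unfolding Er_def by (rule member_le_sum) (auto simp: finite_push_nodes)
qed

section \<open>The weighted average and its descent\<close>

lemma \<psi>_nonneg: "0 \<le> \<psi> N k b"
  unfolding \<psi>_def by (rule mprod_nonneg[of mix, OF mix_nonneg])

lemma \<psi>_sum: "(\<Sum>b\<in>mix_nodes. \<psi> N k b) = 1"
  unfolding \<psi>_def by (rule mprod_row_sum[OF finite_mix_nodes mix_row_sum mix_nodes_0])

lemma \<psi>_le_1: "b \<in> mix_nodes \<Longrightarrow> \<psi> N k b \<le> 1"
  using member_le_sum[of b mix_nodes "\<psi> N k"] \<psi>_sum[of N k] \<psi>_nonneg finite_mix_nodes by simp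

lemma \<psi>_split:
  assumes "k + r \<le> N"
  shows "\<psi> N k b = (\<Sum>c\<in>mix_nodes. \<psi> N (k + r) c * mprod mix_nodes mix k r c b)"
  unfolding \<psi>_def
  using mprod_add[OF finite_mix_nodes mix_nodes_0, of mix k r "N - (k + r)" "sched 0" b] assms
  by (simp del: atMost_Suc)

lemma \<psi>_ge:
  assumes "k + K \<le> N"
  shows "\<eta> \<le> \<psi> N k (l, 0)"
proof -
  have "\<eta> = (\<Sum>c\<in>mix_nodes. \<psi> N (k + K) c * \<eta>)"
    unfolding sum_distrib_right[symmetric] \<psi>_sum by simp
  also have "\<dots> \<le> (\<Sum>c\<in>mix_nodes. \<psi> N (k + K) c * mprod mix_nodes mix k K c (l, 0))"
    by (intro sum_mono mult_left_mono mix_ge \<psi>_nonneg)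
  finally show ?thesis using \<psi>_split[OF assms] by simp
qed

lemma \<psi>_step:
  assumes "k < N" "b \<in> mix_nodes"
  shows "\<psi> N k b = (\<Sum>c\<in>mix_nodes. \<psi> N (Suc k) c * mix k c b)"
proof -
  have "mprod mix_nodes mix k 1 c b = mix k c b" for c
  proof -
    have "mprod mix_nodes mix k 1 c b = (\<Sum>e\<in>mix_nodes. if e = b then mix k c e else 0)"
      by (simp add: if_distrib cong: if_cong)
    then show ?thesis using assms finite_mix_nodes by simp
  qed
  then show ?thesis using \<psi>_split[of k 1 N b] assms by simp
qed

text \<open>Since \<open>\<psi>\<close> at time \<open>k\<close> is \<open>\<psi>\<close> at time
  \<open>k + 1\<close> times the mixing matrix, mixing leaves the average unchanged. Only the input
  at the active node moves it.\<close>

lemma x\<psi>_Suc: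
  assumes "k < N"
  shows "x\<psi> N (Suc k) = x\<psi> N k - (\<gamma> * \<psi> N k (sched k, 0)) *\<^sub>R z k (sched k)"
proof -
  have "x\<psi> N (Suc k) = (\<Sum>a\<in>mix_nodes. \<Sum>b\<in>mix_nodes. (\<psi> N (Suc k) a * mix k a b) *\<^sub>R (mix_state k b + mix_input k b))"
    unfolding x\<psi>_def by (intro sum.cong refl) (simp only: mix_state_Suc scaleR_sum_right scaleR_scaleR)
  also have "\<dots> = (\<Sum>b\<in>mix_nodes. (\<Sum>a\<in>mix_nodes. \<psi> N (Suc k) a * mix k a b) *\<^sub>R (mix_state k b + mix_input k b))"
    unfolding scaleR_sum_left by (rule sum.swap)
  also have "\<dots> = (\<Sum>b\<in>mix_nodes. \<psi> N k b *\<^sub>R (mix_state k b + mix_input k b))"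
    by (intro sum.cong refl) (simp only: \<psi>_step[OF assms])
  also have "\<dots> = x\<psi> N k + (\<Sum>b\<in>mix_nodes. \<psi> N k b *\<^sub>R mix_input k b)"
    unfolding x\<psi>_def by (simp only: scaleR_add_right sum.distrib)
  also have "(\<Sum>b\<in>mix_nodes. \<psi> N k b *\<^sub>R mix_input k b)
      = (\<Sum>b\<in>mix_nodes. if b = (sched k, 0) then - ((\<gamma> * \<psi> N k b) *\<^sub>R z k (sched k)) else 0)"
    by (intro sum.cong) (auto simp: mix_input_def)
  also have "\<dots> = - ((\<gamma> * \<psi> N k (sched k, 0)) *\<^sub>R z k (sched k))"
    unfolding sum.delta[OF finite_mix_nodes] by simp
  finally show ?thesis by simp
qed

lemma x_x\<psi>_le: "norm (x k i - x\<psi> N k) \<le> S k"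
  using norm_diff_weighted_sum_le_spread[OF finite_mix_nodes \<psi>_nonneg \<psi>_sum mix_nodes_0, of "mix_state k" i N k]
  unfolding S_def x\<psi>_def by (simp add: mix_state_def)

definition G :: "nat \<Rightarrow> nat \<Rightarrow> real" where "G N k = norm (GF (x\<psi> N k))"

lemma grad_sum_GF: "norm (grad_sum k - GF (x\<psi> N k)) \<le> \<Lambda> * S k"
  unfolding grad_sum_def by (rule sum_grad_lipschitz[OF x_x\<psi>_le])

lemma z_approx:
  obtains r where "z k i = \<xi> N k (Inl i) *\<^sub>R GF (x\<psi> N k) + r" "norm r \<le> \<Lambda> * S k + Er N k"
proof -
  obtain e where e: "z k i = \<xi> N k (Inl i) *\<^sub>R grad_sum k + e" "norm e \<le> Er N k"
    by (rule z_decomposition)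
  let ?r = "\<xi> N k (Inl i) *\<^sub>R (grad_sum k - GF (x\<psi> N k)) + e"
  have "norm (\<xi> N k (Inl i) *\<^sub>R (grad_sum k - GF (x\<psi> N k))) \<le> 1 * (\<Lambda> * S k)"
    unfolding norm_scaleR using \<xi>_nonneg[of N k "Inl i"] \<xi>_le_1[of "Inl i" N k] grad_sum_GF[of k N]
    by (intro mult_mono) auto
  then have "norm ?r \<le> \<Lambda> * S k + Er N k"
    using e(2) by (intro order_trans[OF norm_triangle_ineq]) simp
  then show ?thesis using e(1) by (intro that[of ?r]) (simp_all add: algebra_simps)
qed

lemma \<zeta>_le: "\<zeta> k \<le> G N k + (\<Lambda> * S k + Er N k)"
proof -
  obtain r where r: "z k (sched k) = \<xi> N k (Inl (sched k)) *\<^sub>R GF (x\<psi> N k) + r" "norm r \<le> \<Lambda> * S k + Er N k"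
    by (rule z_approx)
  have "norm (\<xi> N k (Inl (sched k)) *\<^sub>R GF (x\<psi> N k)) \<le> 1 * G N k"
    unfolding norm_scaleR G_def using \<xi>_nonneg \<xi>_le_1 by (intro mult_right_mono) auto
  then show ?thesis unfolding \<zeta>_def r(1) using r(2) by (intro order_trans[OF norm_triangle_ineq]) simp
qed

lemma noise_square_le: "(\<Lambda> * S k + Er N k)\<^sup>2 \<le> 2 * (\<Lambda>\<^sup>2 + 1) * ((S k)\<^sup>2 + (Er N k)\<^sup>2)"
proof -
  have "(\<Lambda> * S k + Er N k)\<^sup>2 \<le> 2 * ((\<Lambda> * S k)\<^sup>2 + (Er N k)\<^sup>2)"
    using sum_squares_bound[of "\<Lambda> * S k" "Er N k"] by (simp add: power2_sum)
  also have "(\<Lambda> * S k)\<^sup>2 + (Er N k)\<^sup>2 \<le> (\<Lambda>\<^sup>2 + 1) * ((S k)\<^sup>2 + (Er N k)\<^sup>2)"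
    by (simp add: algebra_simps power_mult_distrib)
  finally show ?thesis by (simp only: mult.assoc)
qed

text \<open>The two assumptions place \<open>k\<close> where both \<open>\<xi>\<close> and
  \<open>\<psi>\<close> are at least \<open>\<eta>\<close>, so the step decreases \<open>F\<close>
  by \<open>\<gamma> * \<eta>\<^sup>2 * (G N k)\<^sup>2\<close> to first order. Half of this pays
  for the cross term between gradient and noise.\<close>

lemma descent:
  assumes "K \<le> k" "k + K \<le> N"
  shows "F (x\<psi> N (Suc k)) + \<gamma> * (\<eta>\<^sup>2 / 2) * (G N k)\<^sup>2
    \<le> F (x\<psi> N k) + \<gamma> * ((\<Lambda>\<^sup>2 + 1) / \<eta>\<^sup>2) * ((S k)\<^sup>2 + (Er N k)\<^sup>2) + \<Lambda> * \<gamma>\<^sup>2 * (\<zeta> k)\<^sup>2"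
proof -
  let ?p = "\<psi> N k (sched k, 0)" and ?q = "\<xi> N k (Inl (sched k))" and ?g = "GF (x\<psi> N k)"
  let ?z = "z k (sched k)" and ?n = "\<Lambda> * S k + Er N k"
  obtain r where r: "?z = ?q *\<^sub>R ?g + r" "norm r \<le> ?n" by (rule z_approx)
  have p: "\<eta> \<le> ?p" "?p \<le> 1" using \<psi>_ge[OF assms(2)] \<psi>_le_1[OF mix_nodes_0] by auto
  have q: "\<eta> \<le> ?q" "?q \<le> 1" using \<xi>_ge[OF assms(1)] \<xi>_le_1 by auto
  have "F (x\<psi> N (Suc k)) \<le> F (x\<psi> N k) + ?g \<bullet> (- ((\<gamma> * ?p) *\<^sub>R ?z)) + \<Lambda> * (norm (- ((\<gamma> * ?p) *\<^sub>R ?z)))\<^sup>2"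
    using F_upper_bound[of "x\<psi> N k" "- ((\<gamma> * ?p) *\<^sub>R ?z)"] x\<psi>_Suc[of k N] assms K_pos by simp
  moreover have "\<Lambda> * (norm (- ((\<gamma> * ?p) *\<^sub>R ?z)))\<^sup>2 \<le> \<Lambda> * \<gamma>\<^sup>2 * (\<zeta> k)\<^sup>2"
  proof -
    have "norm (- ((\<gamma> * ?p) *\<^sub>R ?z)) \<le> \<gamma> * 1 * \<zeta> k"
      unfolding norm_minus_cancel norm_scaleR \<zeta>_def using p \<gamma>_pos \<eta>_pos by (intro mult_right_mono) auto
    then have "(norm (- ((\<gamma> * ?p) *\<^sub>R ?z)))\<^sup>2 \<le> (\<gamma> * \<zeta> k)\<^sup>2" by (intro power_mono) auto
    then show ?thesis using mult_left_mono[OF _ \<Lambda>_nonneg] by (simp add: power_mult_distrib mult.assoc)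
  qed
  moreover have "?g \<bullet> (- ((\<gamma> * ?p) *\<^sub>R ?z)) \<le> - \<gamma> * (\<eta>\<^sup>2 / 2) * (G N k)\<^sup>2
      + \<gamma> * ((\<Lambda>\<^sup>2 + 1) / \<eta>\<^sup>2) * ((S k)\<^sup>2 + (Er N k)\<^sup>2)"
  proof -
    have "?g \<bullet> ?z = ?q * (G N k)\<^sup>2 + ?g \<bullet> r"
      unfolding r(1) by (simp add: inner_add_right G_def power2_norm_eq_inner)
    moreover have "?g \<bullet> r \<ge> - (G N k * ?n)"
    proof -
      have "\<bar>?g \<bullet> r\<bar> \<le> G N k * norm r" unfolding G_def by (rule Cauchy_Schwarz_ineq2)
      also have "\<dots> \<le> G N k * ?n" using r(2) by (intro mult_left_mono) (auto simp: G_def)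
      finally show ?thesis by linarith
    qed
    ultimately have "?p * (?g \<bullet> ?z) \<ge> ?p * (?q * (G N k)\<^sup>2 - G N k * ?n)"
      using p \<eta>_pos by (intro mult_left_mono) auto
    moreover have "?p * ?q * (G N k)\<^sup>2 \<ge> \<eta>\<^sup>2 * (G N k)\<^sup>2"
      unfolding power2_eq_square[of \<eta>] using p q \<eta>_pos by (intro mult_right_mono mult_mono) auto
    moreover have "?p * (G N k * ?n) \<le> 1 * (G N k * ?n)"
      using p S_nonneg Er_nonneg \<Lambda>_nonneg by (intro mult_right_mono mult_nonneg_nonneg) (auto simp: G_def)
    \<comment> \<open>Young's inequality, weighted so that the gradient part takes exactly half of
      the available decrease.\<close>
    moreover have "G N k * ?n \<le> \<eta>\<^sup>2 / 2 * (G N k)\<^sup>2 + ?n\<^sup>2 / (2 * \<eta>\<^sup>2)"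
    proof -
      have "0 \<le> (\<eta> * G N k - ?n / \<eta>)\<^sup>2" by simp
      also have "\<dots> = \<eta>\<^sup>2 * (G N k)\<^sup>2 + ?n\<^sup>2 / \<eta>\<^sup>2 - 2 * (G N k * ?n)"
        using \<eta>_pos by (simp add: power2_diff power_mult_distrib power_divide)
      finally show ?thesis by simp
    qed
    moreover have "?n\<^sup>2 / (2 * \<eta>\<^sup>2) \<le> ((\<Lambda>\<^sup>2 + 1) / \<eta>\<^sup>2) * ((S k)\<^sup>2 + (Er N k)\<^sup>2)"
    proof -
      have "?n\<^sup>2 / (2 * \<eta>\<^sup>2) \<le> 2 * (\<Lambda>\<^sup>2 + 1) * ((S k)\<^sup>2 + (Er N k)\<^sup>2) / (2 * \<eta>\<^sup>2)"
        by (rule divide_right_mono[OF noise_square_le]) simp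
      also have "\<dots> = ((\<Lambda>\<^sup>2 + 1) / \<eta>\<^sup>2) * ((S k)\<^sup>2 + (Er N k)\<^sup>2)"
        using \<eta>_pos by (simp add: field_simps)
      finally show ?thesis .
    qed
    ultimately have "- (?p * (?g \<bullet> ?z)) \<le> - (\<eta>\<^sup>2 / 2 * (G N k)\<^sup>2) + ((\<Lambda>\<^sup>2 + 1) / \<eta>\<^sup>2) * ((S k)\<^sup>2 + (Er N k)\<^sup>2)"
      by (simp add: right_diff_distrib mult.assoc)
    then have "\<gamma> * (- (?p * (?g \<bullet> ?z))) \<le> \<gamma> * (- (\<eta>\<^sup>2 / 2 * (G N k)\<^sup>2) + ((\<Lambda>\<^sup>2 + 1) / \<eta>\<^sup>2) * ((S k)\<^sup>2 + (Er N k)\<^sup>2))"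
      using \<gamma>_pos by (intro mult_left_mono) auto
    moreover have "\<gamma> * (- (e * X) + c * Y) = - \<gamma> * e * X + \<gamma> * c * Y" for e X c Y :: real
      by (simp add: algebra_simps)
    moreover have "?g \<bullet> (- ((\<gamma> * ?p) *\<^sub>R ?z)) = \<gamma> * (- (?p * (?g \<bullet> ?z)))" by simp
    ultimately show ?thesis by (simp only:)
  qed
  ultimately show ?thesis by linarith
qed


section \<open>Sums over a finite horizon\<close>

text \<open>The sums start at time \<open>K\<close> because \<open>descent\<close> is available only
  from there.\<close>

lemma sum_squares_S_le:
  "\<eta> * (\<Sum>k<n. (S (K + k))\<^sup>2) \<le> (\<Sum>k<K. (S (K + k))\<^sup>2) + (real K)\<^sup>2 / \<eta> * (4 * \<gamma>\<^sup>2 * (\<Sum>k<n. (\<zeta> (K + k))\<^sup>2))"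
proof -
  have "\<eta> * (\<Sum>k<n. (S (K + k))\<^sup>2)
      \<le> (\<Sum>k<K. (S (K + k))\<^sup>2) + (real K)\<^sup>2 / \<eta> * (\<Sum>k<n. (2 * (\<gamma> * \<zeta> (K + k)))\<^sup>2)"
  proof (rule window_contraction_sum_squares[OF \<eta>_pos \<eta>_le_1 S_nonneg])
    show "0 \<le> 2 * (\<gamma> * \<zeta> (K + k))" for k using \<gamma>_pos \<zeta>_nonneg by simp
    show "S (K + (k + K)) \<le> (1 - \<eta>) * S (K + k) + (\<Sum>t<K. 2 * (\<gamma> * \<zeta> (K + (k + t))))" for k
      using S_contraction[of "K + k"] by (simp only: add.assoc)
  qed
  then show ?thesis by (simp add: power_mult_distrib sum_distrib_left mult.assoc)
qed

text \<open>The room of \<open>2 * K\<close> keeps every contraction window inside the horizon and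
  lets \<open>Er_le_bound\<close> cover the first window.\<close>

lemma sum_squares_Er_le:
  assumes "n + 2 * K \<le> N"
  shows "\<eta> * (\<Sum>k<n. (Er N (K + k))\<^sup>2) \<le> (\<Sum>k<K. (Er_bound (K + k))\<^sup>2)
    + (real K)\<^sup>2 / \<eta> * (8 * \<Lambda>\<^sup>2 * ((\<Sum>k<n. (S (K + k))\<^sup>2) + \<gamma>\<^sup>2 * (\<Sum>k<n. (\<zeta> (K + k))\<^sup>2)))"
proof -
  let ?u = "\<lambda>k. 2 * (\<Lambda> * (S k + \<gamma> * \<zeta> k))"
  have "\<eta> * (\<Sum>k<n. (Er N (K + k))\<^sup>2)
      \<le> (\<Sum>k<K. (Er N (K + k))\<^sup>2) + (real K)\<^sup>2 / \<eta> * (\<Sum>k<n. (?u (K + k))\<^sup>2)"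
  proof (rule window_contraction_sum_squares[OF \<eta>_pos \<eta>_le_1 Er_nonneg])
    show "0 \<le> ?u (K + k)" for k using \<gamma>_pos \<zeta>_nonneg S_nonneg \<Lambda>_nonneg by simp
    show "Er N (K + (k + K)) \<le> (1 - \<eta>) * Er N (K + k) + (\<Sum>t<K. ?u (K + (k + t)))" if "k + K < n" for k
      using Er_contraction[of "K + k" N] assms that by (simp add: add.assoc)
  qed
  also have "(\<Sum>k<K. (Er N (K + k))\<^sup>2) \<le> (\<Sum>k<K. (Er_bound (K + k))\<^sup>2)"
    using assms by (intro sum_mono power_mono Er_le_bound Er_nonneg) auto
  also have "(\<Sum>k<n. (?u (K + k))\<^sup>2)
      \<le> (\<Sum>k<n. 8 * \<Lambda>\<^sup>2 * ((S (K + k))\<^sup>2 + \<gamma>\<^sup>2 * (\<zeta> (K + k))\<^sup>2))"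
  proof (rule sum_mono)
    fix k
    have "(S (K + k) + \<gamma> * \<zeta> (K + k))\<^sup>2 \<le> 2 * ((S (K + k))\<^sup>2 + (\<gamma> * \<zeta> (K + k))\<^sup>2)"
      using sum_squares_bound[of "S (K + k)" "\<gamma> * \<zeta> (K + k)"] by (simp add: power2_sum)
    then have le: "4 * \<Lambda>\<^sup>2 * (S (K + k) + \<gamma> * \<zeta> (K + k))\<^sup>2
        \<le> 4 * \<Lambda>\<^sup>2 * (2 * ((S (K + k))\<^sup>2 + (\<gamma> * \<zeta> (K + k))\<^sup>2))"
      by (intro mult_left_mono) auto
    have "(?u (K + k))\<^sup>2 = 4 * \<Lambda>\<^sup>2 * (S (K + k) + \<gamma> * \<zeta> (K + k))\<^sup>2"
      by (simp add: power_mult_distrib)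
    also note le
    also have "4 * \<Lambda>\<^sup>2 * (2 * ((S (K + k))\<^sup>2 + (\<gamma> * \<zeta> (K + k))\<^sup>2))
        = 8 * \<Lambda>\<^sup>2 * ((S (K + k))\<^sup>2 + \<gamma>\<^sup>2 * (\<zeta> (K + k))\<^sup>2)"
      by (simp add: power_mult_distrib)
    finally show "(?u (K + k))\<^sup>2 \<le> 8 * \<Lambda>\<^sup>2 * ((S (K + k))\<^sup>2 + \<gamma>\<^sup>2 * (\<zeta> (K + k))\<^sup>2)" .
  qed
  also have "\<dots> = 8 * \<Lambda>\<^sup>2 * ((\<Sum>k<n. (S (K + k))\<^sup>2) + \<gamma>\<^sup>2 * (\<Sum>k<n. (\<zeta> (K + k))\<^sup>2))"
    by (simp add: sum_distrib_left[symmetric] sum.distrib)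
  finally show ?thesis using \<eta>_pos by (simp add: mult_left_mono divide_right_mono)
qed

lemma \<zeta>_square_le: "(\<zeta> k)\<^sup>2 \<le> 3 * (G N k)\<^sup>2 + 4 * (\<Lambda>\<^sup>2 + 1) * ((S k)\<^sup>2 + (Er N k)\<^sup>2)"
proof -
  have "(\<zeta> k)\<^sup>2 \<le> (G N k + (\<Lambda> * S k + Er N k))\<^sup>2"
    by (intro power_mono \<zeta>_le \<zeta>_nonneg)
  also have "\<dots> \<le> 2 * ((G N k)\<^sup>2 + (\<Lambda> * S k + Er N k)\<^sup>2)"
    using sum_squares_bound[of "G N k" "\<Lambda> * S k + Er N k"] by (simp add: power2_sum[of "G N k"])
  also have "\<dots> \<le> 2 * ((G N k)\<^sup>2 + 2 * (\<Lambda>\<^sup>2 + 1) * ((S k)\<^sup>2 + (Er N k)\<^sup>2))"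
    using noise_square_le[of k N] by simp
  also have "\<dots> \<le> 3 * (G N k)\<^sup>2 + 4 * (\<Lambda>\<^sup>2 + 1) * ((S k)\<^sup>2 + (Er N k)\<^sup>2)"
    by (simp add: algebra_simps)
  finally show ?thesis .
qed

lemma descent_sum:
  assumes "j + 2 * K \<le> N"
  shows "F (x\<psi> N (K + j)) + \<gamma> * (\<eta>\<^sup>2 / 2) * (\<Sum>k<j. (G N (K + k))\<^sup>2)
    \<le> F (x\<psi> N K) + \<gamma> * ((\<Lambda>\<^sup>2 + 1) / \<eta>\<^sup>2) * (\<Sum>k<j. (S (K + k))\<^sup>2 + (Er N (K + k))\<^sup>2)
      + \<Lambda> * \<gamma>\<^sup>2 * (\<Sum>k<j. (\<zeta> (K + k))\<^sup>2)"
  using assms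
proof (induction j)
  case 0
  then show ?case by simp
next
  case (Suc j)
  show ?case
    using Suc.IH descent[of "K + j" N] Suc.prems
    by (simp only: sum.lessThan_Suc add_Suc_right distrib_left) (simp add: distrib_left)
qed

text \<open>The start value of the descent depends on \<open>N\<close> through the weights; this
  bound replaces it by data of the trajectory at time \<open>K\<close>.\<close>

lemma F_start_le: "F (x\<psi> N K) \<le> F (x K (sched 0)) + norm (GF (x K (sched 0))) * S K + \<Lambda> * (S K)\<^sup>2"
proof -
  let ?x = "x K (sched 0)"
  let ?h = "x\<psi> N K - ?x"
  have h: "norm ?h \<le> S K" using x_x\<psi>_le[of K "sched 0" N] by (simp add: norm_minus_commute)
  have "F (x\<psi> N K) \<le> F ?x + GF ?x \<bullet> ?h + \<Lambda> * (norm ?h)\<^sup>2"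
    using F_upper_bound[of ?x ?h] by simp
  also have "GF ?x \<bullet> ?h \<le> norm (GF ?x) * S K"
    using norm_cauchy_schwarz[of "GF ?x" ?h] mult_left_mono[OF h, of "norm (GF ?x)"] by simp
  also have "\<Lambda> * (norm ?h)\<^sup>2 \<le> \<Lambda> * (S K)\<^sup>2"
    using h by (intro mult_left_mono power_mono \<Lambda>_nonneg) auto
  finally show ?thesis by simp
qed

lemma merit_nonneg: "0 \<le> merit grad (x k)"
  by (simp add: merit_def le_max_iff_disj)

text \<open>Every iterate is within \<open>S k\<close> of \<open>x\<psi>\<close>, hence so is their
  mean. Passing to the gradient at the mean therefore costs \<open>\<Lambda> * S k\<close>.\<close>

lemma merit_le: "merit grad (x k) \<le> 2 * (G N k)\<^sup>2 + (2 * \<Lambda>\<^sup>2 + real CARD('v)) * (S k)\<^sup>2"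
proof -
  have xx: "norm (x k i - x k j) \<le> S k" for i j
    using norm_diff_le_spread[OF finite_mix_nodes mix_nodes_0 mix_nodes_0, of "mix_state k" i j]
    by (simp add: S_def mix_state_def)
  have xb: "norm (x k i - xbar (x k)) \<le> S k" for i
    by (rule norm_diff_xbar_le) (rule xx)
  have "norm (x\<psi> N k - xbar (x k)) \<le> S k"
    by (rule norm_diff_xbar_le) (simp add: norm_minus_commute x_x\<psi>_le)
  then have "norm (GF (xbar (x k)) - GF (x\<psi> N k)) \<le> \<Lambda> * S k"
    using GF_lipschitz[of "xbar (x k)" "x\<psi> N k"] mult_left_mono[OF _ \<Lambda>_nonneg]
    by (metis norm_minus_commute order_trans)
  then have "norm (GF (xbar (x k))) \<le> G N k + \<Lambda> * S k"
    unfolding G_def using norm_triangle_sub[of "GF (xbar (x k))" "GF (x\<psi> N k)"] by linarith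
  then have "(norm (GF (xbar (x k))))\<^sup>2 \<le> (G N k + \<Lambda> * S k)\<^sup>2" by (intro power_mono) auto
  also have "\<dots> \<le> 2 * (G N k)\<^sup>2 + 2 * \<Lambda>\<^sup>2 * (S k)\<^sup>2"
    using sum_squares_bound[of "G N k" "\<Lambda> * S k"] by (simp add: power2_sum power_mult_distrib)
  finally have 1: "(norm (GF (xbar (x k))))\<^sup>2 \<le> 2 * (G N k)\<^sup>2 + 2 * \<Lambda>\<^sup>2 * (S k)\<^sup>2" .
  have "(\<Sum>i\<in>UNIV. (norm (x k i - xbar (x k)))\<^sup>2) \<le> (\<Sum>i\<in>(UNIV::'v set). (S k)\<^sup>2)"
    using xb by (intro sum_mono power_mono) auto
  then have 2: "(\<Sum>i\<in>UNIV. (norm (x k i - xbar (x k)))\<^sup>2) \<le> real CARD('v) * (S k)\<^sup>2" by simp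
  have nn: "0 \<le> 2 * (G N k)\<^sup>2" "0 \<le> 2 * \<Lambda>\<^sup>2 * (S k)\<^sup>2" "0 \<le> real CARD('v) * (S k)\<^sup>2" by simp_all
  show ?thesis
    unfolding merit_def GF_def[symmetric] distrib_right using 1 2 nn by (intro max.boundedI) linarith+
qed

text \<open>\<open>c4\<close> is the coefficient of \<open>\<gamma>\<^sup>2\<close> times the sum of
  \<open>\<zeta>\<^sup>2\<close> in the bound for disagreement plus tracking error. Its first
  summand comes from the disagreement, the second from the tracking error, which is itself driven by
  the disagreement.\<close>

lemma merit_sum_bounded:
  defines "\<kappa> \<equiv> (real K)\<^sup>2 / \<eta>"
  defines "c4 \<equiv> 4 * \<kappa> / \<eta> + 8 * \<kappa> * \<Lambda>\<^sup>2 / \<eta> * (4 * \<kappa> / \<eta> + 1)"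
  assumes bdd: "\<And>y. b \<le> F y"
    and g1: "\<gamma>\<^sup>2 * (4 * (\<Lambda>\<^sup>2 + 1) * c4) \<le> 1 / 2"
    and g2: "24 * ((\<Lambda>\<^sup>2 + 1) / \<eta>\<^sup>2 * c4) * \<gamma>\<^sup>2 \<le> \<eta>\<^sup>2 / 2"
    and g3: "24 * \<Lambda> * \<gamma> \<le> \<eta>\<^sup>2 / 2"
  shows "\<exists>C. \<forall>n. (\<Sum>k<n. merit grad (x k)) \<le> C"
proof -
  define a where "a = \<eta>\<^sup>2 / 2"
  define c1 where "c1 = (\<Lambda>\<^sup>2 + 1) / \<eta>\<^sup>2"
  define c3 where "c3 = 4 * (\<Lambda>\<^sup>2 + 1)"
  define CS where "CS = (\<Sum>k<K. (S (K + k))\<^sup>2)"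
  define CE where "CE = (\<Sum>k<K. (Er_bound (K + k))\<^sup>2)"
  define C1 where "C1 = CS / \<eta> + CE / \<eta> + 8 * \<kappa> * \<Lambda>\<^sup>2 / \<eta> * (CS / \<eta>)"
  define C2 where "C2 = F (x K (sched 0)) + norm (GF (x K (sched 0))) * S K + \<Lambda> * (S K)\<^sup>2 - b"
  define BX where "BX = 2 * (C2 + 2 * \<gamma> * c1 * C1 + 2 * \<Lambda> * \<gamma>\<^sup>2 * c3 * C1) / (\<gamma> * a)"
  define BY where "BY = 2 * C1 + 6 * c4 * \<gamma>\<^sup>2 * BX"
  have \<kappa>: "0 \<le> \<kappa>" using \<eta>_pos by (simp add: \<kappa>_def)
  have c4: "0 \<le> c4" using \<kappa> \<eta>_pos by (simp add: c4_def)
  have tail: "(\<Sum>k<n. merit grad (x (K + k))) \<le> 2 * BX + (2 * \<Lambda>\<^sup>2 + real CARD('v)) * BY" for n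
  proof -
    \<comment> \<open>For \<open>k < n\<close> the time \<open>K + k\<close> is then at least
      \<open>K\<close> steps away from both ends of the horizon, as \<open>descent\<close>
      requires.\<close>
    define N where "N = n + 2 * K"
    define X where "X = (\<Sum>k<n. (G N (K + k))\<^sup>2)"
    define YS where "YS = (\<Sum>k<n. (S (K + k))\<^sup>2)"
    define YE where "YE = (\<Sum>k<n. (Er N (K + k))\<^sup>2)"
    define Z where "Z = (\<Sum>k<n. (\<zeta> (K + k))\<^sup>2)"
    have nn: "0 \<le> X" "0 \<le> YS" "0 \<le> YE" "0 \<le> Z"
      unfolding X_def YS_def YE_def Z_def by (intro sum_nonneg zero_le_power2)+
    have "\<eta> * YS \<le> CS + \<kappa> * (4 * \<gamma>\<^sup>2 * Z)"
      unfolding YS_def CS_def \<kappa>_def Z_def by (rule sum_squares_S_le)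
    then have YS: "YS \<le> CS / \<eta> + 4 * \<kappa> / \<eta> * (\<gamma>\<^sup>2 * Z)"
      using \<eta>_pos by (simp add: field_simps)
    have "\<eta> * YE \<le> CE + \<kappa> * (8 * \<Lambda>\<^sup>2 * (YS + \<gamma>\<^sup>2 * Z))"
      unfolding YS_def YE_def CE_def \<kappa>_def Z_def by (rule sum_squares_Er_le) (simp add: N_def)
    then have "YE \<le> CE / \<eta> + 8 * \<kappa> * \<Lambda>\<^sup>2 / \<eta> * (YS + \<gamma>\<^sup>2 * Z)"
      using \<eta>_pos by (simp add: field_simps)
    also have "\<dots> \<le> CE / \<eta> + 8 * \<kappa> * \<Lambda>\<^sup>2 / \<eta> * ((CS / \<eta> + 4 * \<kappa> / \<eta> * (\<gamma>\<^sup>2 * Z)) + \<gamma>\<^sup>2 * Z)"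
      using YS \<kappa> \<eta>_pos by (intro add_left_mono mult_left_mono add_right_mono) auto
    finally have YE: "YE \<le> CE / \<eta> + 8 * \<kappa> * \<Lambda>\<^sup>2 / \<eta> * ((CS / \<eta> + 4 * \<kappa> / \<eta> * (\<gamma>\<^sup>2 * Z)) + \<gamma>\<^sup>2 * Z)" .
    have "YS + YE \<le> C1 + c4 * \<gamma>\<^sup>2 * Z"
    proof -
      define p r where "p = 4 * \<kappa> / \<eta>" and "r = 8 * \<kappa> * \<Lambda>\<^sup>2 / \<eta>"
      have "C1 = CS / \<eta> + CE / \<eta> + r * (CS / \<eta>)" "c4 = p + r * (p + 1)"
        by (simp_all add: C1_def c4_def p_def r_def)
      then show ?thesis
        using YS YE unfolding p_def[symmetric] r_def[symmetric] by (simp add: algebra_simps)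
    qed
    moreover have "Z \<le> 3 * X + c3 * (YS + YE)"
    proof -
      have "Z \<le> (\<Sum>k<n. 3 * (G N (K + k))\<^sup>2 + c3 * ((S (K + k))\<^sup>2 + (Er N (K + k))\<^sup>2))"
        unfolding Z_def c3_def by (intro sum_mono \<zeta>_square_le)
      then show ?thesis
        unfolding X_def YS_def YE_def by (simp add: sum.distrib sum_distrib_left distrib_left)
    qed
    moreover have "\<gamma> * a * X \<le> C2 + \<gamma> * c1 * (YS + YE) + \<Lambda> * \<gamma>\<^sup>2 * Z"
    proof -
      have "F (x\<psi> N (K + n)) + \<gamma> * a * X \<le> F (x\<psi> N K) + \<gamma> * c1 * (YS + YE) + \<Lambda> * \<gamma>\<^sup>2 * Z"
        unfolding X_def YS_def YE_def Z_def a_def c1_def sum.distrib[symmetric]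
        by (rule descent_sum) (simp add: N_def)
      then show ?thesis
        unfolding C2_def using bdd[of "x\<psi> N (K + n)"] F_start_le[of N] by linarith
    qed
    moreover have "0 \<le> YS + YE" using nn by simp
    moreover have "0 < a" "0 \<le> c1" "0 \<le> c3" using \<eta>_pos by (simp_all add: a_def c1_def c3_def)
    ultimately have "X \<le> BX" "YS + YE \<le> 2 * C1 + 6 * c4 * \<gamma>\<^sup>2 * X"
      using small_step_closure[of X "YS + YE" \<gamma> a c1 c3 c4 \<Lambda> C1 Z C2] nn \<gamma>_pos c4 \<Lambda>_nonneg g1 g2 g3
      unfolding BX_def a_def c1_def c3_def by blast+
    moreover from \<open>X \<le> BX\<close> have "6 * c4 * \<gamma>\<^sup>2 * X \<le> 6 * c4 * \<gamma>\<^sup>2 * BX"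
      using c4 by (intro mult_left_mono) auto
    ultimately have XY: "X \<le> BX" "YS \<le> BY" using nn by (simp_all add: BY_def)
    have "(\<Sum>k<n. merit grad (x (K + k)))
        \<le> (\<Sum>k<n. 2 * (G N (K + k))\<^sup>2 + (2 * \<Lambda>\<^sup>2 + real CARD('v)) * (S (K + k))\<^sup>2)"
      by (intro sum_mono merit_le)
    also have "\<dots> = 2 * X + (2 * \<Lambda>\<^sup>2 + real CARD('v)) * YS"
      by (simp add: X_def YS_def sum.distrib sum_distrib_left)
    also have "\<dots> \<le> 2 * BX + (2 * \<Lambda>\<^sup>2 + real CARD('v)) * BY"
      using XY by (intro add_mono mult_left_mono) auto
    finally show ?thesis .
  qed
  have "(\<Sum>k<n. merit grad (x k)) \<le> (\<Sum>k<K. merit grad (x k)) + (2 * BX + (2 * \<Lambda>\<^sup>2 + real CARD('v)) * BY)" for n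
  proof -
    \<comment> \<open>Adding \<open>K\<close> nonnegative terms avoids a separate case for
      \<open>n < K\<close>.\<close>
    have "(\<Sum>k<n. merit grad (x k)) \<le> (\<Sum>k<n + K. merit grad (x k))"
      by (intro sum_mono2) (auto simp: merit_nonneg)
    also have "\<dots> = (\<Sum>k<K. merit grad (x k)) + (\<Sum>k<n. merit grad (x (K + k)))"
      by (induction n) (simp_all add: ac_simps)
    finally show ?thesis using tail[of n] by simp
  qed
  then show ?thesis by blast
qed

end

section \<open>The hitting time and the choice of the step-size\<close>

text \<open>If all \<open>M k\<close> with \<open>k < n\<close> exceed \<open>\<delta>\<close>, then
  \<open>n * \<delta>\<close> is at most the sum, hence at most \<open>C\<close>. Unbounded
  \<open>n\<close> would contradict the Archimedean property; the least index is such an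
  \<open>n\<close>.\<close>

lemma least_le_of_bounded_sums:
  fixes M :: "nat \<Rightarrow> real"
  assumes M: "\<And>k. 0 \<le> M k" and C: "\<And>n. (\<Sum>k<n. M k) \<le> C" and \<delta>: "0 < \<delta>"
  shows "(\<exists>k. M k \<le> \<delta>) \<and> real (LEAST k. M k \<le> \<delta>) \<le> C / \<delta>"
proof -
  have bound: "real n * \<delta> \<le> C" if "\<And>k. k < n \<Longrightarrow> \<not> M k \<le> \<delta>" for n
  proof -
    have "real n * \<delta> = (\<Sum>k<n. \<delta>)" by simp
    also have "\<dots> \<le> (\<Sum>k<n. M k)" using that by (intro sum_mono) force
    finally show ?thesis using C[of n] by simp
  qed
  have "\<exists>k. M k \<le> \<delta>"
  proof (rule ccontr)
    assume "\<not> ?thesis"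
    then have "real n * \<delta> \<le> C" for n using bound by blast
    then show False using reals_Archimedean3[OF \<delta>, rule_format, of C] by (meson not_le)
  qed
  moreover have "real (LEAST k. M k \<le> \<delta>) * \<delta> \<le> C"
    by (rule bound) (rule not_less_Least)
  ultimately show ?thesis using \<delta> by (simp add: pos_le_divide_eq)
qed

theorem theorem3:
  fixes f :: "'v::finite \<Rightarrow> 'a::euclidean_space \<Rightarrow> real"
    and grad :: "'v \<Rightarrow> 'a \<Rightarrow> 'a"
    and L :: "'v \<Rightarrow> real"
    and E :: "('v \<times> 'v) set"
    and W A :: "'v \<Rightarrow> 'v \<Rightarrow> real"
    and mbar :: real and T D :: nat
    and sched :: "nat \<Rightarrow> 'v" and d :: "nat \<Rightarrow> 'v \<Rightarrow> nat"
    and x0 :: "'v \<Rightarrow> 'a"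
  assumes grad: "\<And>i y. (f i has_derivative (\<lambda>h. grad i y \<bullet> h)) (at y)"
    and lips: "\<And>i. lipschitz_on (L i) UNIV (grad i)"
    and bdd: "\<exists>b. \<forall>y. (\<Sum>i\<in>UNIV. f i y) \<ge> b"
    and noloops: "\<forall>i. (i, i) \<notin> E"
    and strongly_connected: "\<forall>i j. (i, j) \<in> E\<^sup>*"
    and mbar: "0 < mbar" "mbar < 1"
    and W: "row_stochastic W" "weight_pattern E mbar W"
    and A: "col_stochastic A" "weight_pattern E mbar A"
    and sched: "admissible_schedule E T D sched d"
  shows "\<exists>\<gamma>bar2 > 0. \<forall>\<gamma>. 0 < \<gamma> \<and> \<gamma> < \<gamma>bar2 \<longrightarrow>
           (\<forall>x z v rho rt tau.
              x 0 = x0 \<and> asy_sonata E W A grad D \<gamma> sched d x z v rho rt tau \<longrightarrow>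
              (\<exists>C. \<forall>\<delta> > 0. (\<exists>k. merit grad (x k) \<le> \<delta>) \<and>
                        real (LEAST k. merit grad (x k) \<le> \<delta>) \<le> C / \<delta>))"
proof -
  interpret async_network E W A mbar T D sched d
    using noloops strongly_connected mbar W A sched by unfold_locales auto
  obtain K \<eta> where K: "0 < K" and \<eta>: "0 < \<eta>" "\<eta> \<le> 1"
    and mixp: "\<And>s l a. a \<in> mix_nodes \<Longrightarrow> \<eta> \<le> mprod mix_nodes mix s K a (l, 0)"
    and pushp: "\<And>N s l b. b \<in> push_nodes N \<Longrightarrow> \<eta> \<le> mprod (push_nodes N) (push N) s K (Inl l) b"
    using uniform_positivity by blast
  obtain b where b: "\<And>y. b \<le> (\<Sum>i\<in>UNIV. f i y)" using bdd by blast
  define Ltot where "Ltot = (\<Sum>i\<in>UNIV. L i)"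
  define \<kappa> where "\<kappa> = (real K)\<^sup>2 / \<eta>"
  define c4 where "c4 = 4 * \<kappa> / \<eta> + 8 * \<kappa> * Ltot\<^sup>2 / \<eta> * (4 * \<kappa> / \<eta> + 1)"
  define p where "p = 4 * (Ltot\<^sup>2 + 1) * c4"
  define q where "q = 24 * ((Ltot\<^sup>2 + 1) / \<eta>\<^sup>2 * c4)"
  have Ltot_nonneg: "0 \<le> Ltot" unfolding Ltot_def by (intro sum_nonneg lipschitz_on_nonneg[OF lips])
  have c4: "0 \<le> c4" using \<eta> by (simp add: c4_def \<kappa>_def)
  have pq: "0 \<le> p" "0 \<le> q" using c4 \<eta> by (simp_all add: p_def q_def)
  \<comment> \<open>The cap 1 gives \<open>\<gamma>\<^sup>2 \<le> \<gamma>\<close> and makes the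
    quadratic conditions of \<open>merit_sum_bounded\<close> linear. The second entry yields its
    condition \<open>g1\<close>, the third both \<open>g2\<close> and \<open>g3\<close>; the added 1
    keeps the denominators positive.\<close>
  define g where "g = min 1 (min (1 / 2 / (p + 1)) (\<eta>\<^sup>2 / 2 / (q + 24 * Ltot + 1)))"
  have "0 < g" using pq Ltot_nonneg \<eta> by (simp add: g_def add_nonneg_pos)
  moreover have "\<exists>C. \<forall>\<delta>>0. (\<exists>k. merit grad (x k) \<le> \<delta>) \<and> real (LEAST k. merit grad (x k) \<le> \<delta>) \<le> C / \<delta>"
    if \<gamma>: "0 < \<gamma>" "\<gamma> < g" and run: "asy_sonata E W A grad D \<gamma> sched d x z v rho rt tau"
    for \<gamma> x z v rho rt tau
  proof -
    interpret smooth_run E W A mbar T D sched d grad \<gamma> x z v rho rt tau f L K \<eta>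
      using run grad lips \<gamma> K \<eta> mixp pushp by unfold_locales
    have \<Lambda>: "\<Lambda> = Ltot" by (simp add: Ltot_def \<Lambda>_def)
    have "\<gamma> < 1" using \<gamma> by (simp add: g_def)
    then have sq: "\<gamma>\<^sup>2 \<le> \<gamma>" using \<gamma> by (simp add: power2_eq_square mult_le_cancel_left1)
    have "\<gamma> * (p + 1) \<le> 1 / 2" 
      using \<gamma>(2) pq by (simp add: g_def pos_less_divide_eq field_simps)
    moreover have "\<gamma>\<^sup>2 * p \<le> \<gamma> * p" using sq pq by (intro mult_right_mono) auto
    ultimately have g1: "\<gamma>\<^sup>2 * p \<le> 1 / 2" using \<gamma>(1) by (simp add: algebra_simps)
    have "\<gamma> < \<eta>\<^sup>2 / 2 / (q + 24 * Ltot + 1)" using \<gamma>(2) by (simp add: g_def)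
    then have "\<gamma> * (q + 24 * Ltot + 1) \<le> \<eta>\<^sup>2 / 2"
      using pq Ltot_nonneg by (subst (asm) pos_less_divide_eq) auto
    then have g: "\<gamma> * q + \<gamma> * (24 * Ltot) + \<gamma> \<le> \<eta>\<^sup>2 / 2" by (simp add: algebra_simps)
    have "q * \<gamma>\<^sup>2 \<le> \<gamma> * q" using sq pq mult_left_mono[OF sq, of q] by (simp add: mult.commute)
    moreover have "0 \<le> \<gamma> * (24 * Ltot)" using \<gamma>(1) Ltot_nonneg by simp
    ultimately have g2: "q * \<gamma>\<^sup>2 \<le> \<eta>\<^sup>2 / 2" using g \<gamma>(1) by linarith
    have "0 \<le> \<gamma> * q" using \<gamma>(1) pq by simp
    then have "\<gamma> * (24 * Ltot) \<le> \<eta>\<^sup>2 / 2" using g \<gamma>(1) by linarith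
    then have g3: "24 * Ltot * \<gamma> \<le> \<eta>\<^sup>2 / 2" by (simp only: mult.commute[of _ \<gamma>])
    obtain C where "\<And>n. (\<Sum>k<n. merit grad (x k)) \<le> C"
      using merit_sum_bounded[of b] b g1 g2 g3
      unfolding \<Lambda> F_def p_def q_def c4_def \<kappa>_def by blast
    then show ?thesis
      using least_le_of_bounded_sums[of "\<lambda>k. merit grad (x k)" C] merit_nonneg by blast
  qed
  ultimately show ?thesis by blast
qed

end
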